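(* Let $n\geq3$ and $2\le k\le n$ be integers. The $\mathcal{G}^k_n$-parking functions are exactly the $k$-partial parking functions in $[n]^n$, and their number is $(n+1)^{n-1}$.
   Context: $[m,n]=\{i\in\mathbb{Z}\mid m\le i\le n\}$, $[n]=[1,n]$. The arrangement $\mathcal{A}^k_n$ in $\mathbb{R}^n$ consists of the hyperplanes $x_i=x_j$ for $1\le i<j\le n$; $x_1=x_j+i$ for $1\le i<j\le n$ with $i<k$; and $x_i=x_j+1$ for $k\le i<j\le n$. $\mathcal{G}^k_n$ is the directed multigraph on vertex set $[n]$ having one arc $(i,j)$ for each hyperplane $x_i=x_j$ ($i<j$) of $\mathcal{A}^k_n$ and one arc $(j,i)$ for each hyperplane $x_i=x_j+a$ ($a\in\mathbb{N}$) of $\mathcal{A}^k_n$ (multiple arcs counted with multiplicity). For a directed loopless connected multigraph $\mathcal{G}=([n],A)$, $\mathbf{a}\in\mathbb{N}^n$ is a $\mathcal{G}$-parking function if for every nonempty $I\subseteq[n]$ there is $i\in I$ such that the number of arcs $(i,j)\in A$ with $j\notin I$, counted with multiplicity, is greater than $a_i-2$. Parking Algorithm with input $\mathbf{a}\in[n]^n$: start with $\mathrm{spp}=(0,\dotsc,0)\in\mathbb{Z}^{2n}$ indexed by positions $1,\dotsc,2n$; for each $i\in[n]$ in descending order set $p=a_i$, increase $p$ by one while $\mathrm{spp}(p)\ne0$, then set $\mathrm{pp}(i)=p$, $\mathrm{spp}(p)=i$. $\mathbf{a}$ parks $i$ if $\mathrm{pp}(i)\le n$. Centre: $Z(\mathbf{b})$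 is the largest set $\{i_1,\dotsc,i_m\}\subseteq[n]$ with $i_1>\dotsb>i_m$ and $b_{i_j}\le j$ for all $j\in[m]$. Let $\pi\in\mathfrak{S}_n$ with $\pi(i)=i$ for $i<k$ and $a_{\pi(i)}\ge a_{\pi(i+1)}$ for $k\le i<n$, and $\mathbf{a}^{(k)}:=\mathbf{a}\circ\pi$. $\mathbf{a}\in[n]^n$ is a $k$-partial parking function if $\mathbf{a}$ parks every element of $[k,n]$ and $1\in Z(\mathbf{a}^{(k)})$. *)

theory Defs
  imports
    Complex_Main
    "HOL-Library.FuncSet"
    "HOL-Library.While_Combinator"
    "HOL-Combinatorics.Permutations"
    "Graph_Theory.Digraph_Component"
begin

text \<open>
  Points of $\mathbb{R}^n$, of $\mathbb{N}^n$ and of $[n]^n$ are extensional functions on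
  \<^term>\<open>{1..n::nat}\<close>. The set $\mathbb{N}$ consists of the positive integers.
\<close>

subsection \<open>The arrangement and its multigraph\<close>

definition hyperplane :: "nat \<Rightarrow> nat \<Rightarrow> nat \<Rightarrow> nat \<Rightarrow> (nat \<Rightarrow> real) set" where
  "hyperplane n i j a = {x \<in> {1..n} \<rightarrow>\<^sub>E UNIV. x i = x j + real a}"

definition arrangement :: "nat \<Rightarrow> nat \<Rightarrow> (nat \<Rightarrow> real) set set" where
  "arrangement n k =
     {hyperplane n i j 0 | i j. 1 \<le> i \<and> i < j \<and> j \<le> n} \<union>
     {hyperplane n 1 j i | i j. 1 \<le> i \<and> i < j \<and> j \<le> n \<and> i < k} \<union>
     {hyperplane n i j 1 | i j. k \<le> i \<and> i < j \<and> j \<le> n}"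

definition arc_ends_of :: "nat \<Rightarrow> (nat \<Rightarrow> real) set \<Rightarrow> nat \<times> nat" where
  "arc_ends_of n H =
     (THE e. \<exists>i\<in>{1..n}. \<exists>j\<in>{1..n}.
        (i < j \<and> H = hyperplane n i j 0 \<and> e = (i, j)) \<or>
        (\<exists>a\<ge>1. H = hyperplane n i j a \<and> e = (j, i)))"

text \<open>The arcs are the hyperplanes themselves, so parallel arcs stay distinct.\<close>

definition arr_graph :: "nat \<Rightarrow> nat \<Rightarrow> (nat, (nat \<Rightarrow> real) set) pre_digraph" where
  "arr_graph n k =
     \<lparr>verts = {1..n}, arcs = arrangement n k,
      tail = (\<lambda>H. fst (arc_ends_of n H)), head = (\<lambda>H. snd (arc_ends_of n H))\<rparr>"

definition graph_parking_function :: "(nat, 'b) pre_digraph \<Rightarrow> (nat \<Rightarrow> nat) \<Rightarrow> bool" where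
  "graph_parking_function G a \<longleftrightarrow>
     a \<in> verts G \<rightarrow>\<^sub>E {1..} \<and>
     (\<forall>I. I \<subseteq> verts G \<and> I \<noteq> {} \<longrightarrow>
        (\<exists>i\<in>I. int (card {e \<in> arcs G. tail G e = i \<and> head G e \<notin> I}) > int (a i) - 2))"

subsection \<open>Partial parking functions\<close>

text \<open>
  The state of the algorithm is the pair (spp, pp). For input in $[n]^n$ only the positions
  $1,\ldots,2n$ are ever visited, so spp is kept as a total function.
\<close>

definition park_step ::
  "(nat \<Rightarrow> nat) \<Rightarrow> nat \<Rightarrow> (nat \<Rightarrow> nat) \<times> (nat \<Rightarrow> nat) \<Rightarrow> (nat \<Rightarrow> nat) \<times> (nat \<Rightarrow> nat)" where
  "park_step a i = (\<lambda>(spp, pp).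
     let p = while (\<lambda>p. spp p \<noteq> 0) Suc (a i) in (spp(p := i), pp(i := p)))"

definition park_pos :: "nat \<Rightarrow> (nat \<Rightarrow> nat) \<Rightarrow> nat \<Rightarrow> nat" where
  "park_pos n a = snd (fold (park_step a) (rev [1..<Suc n]) (\<lambda>_. 0, \<lambda>_. 0))"

definition parks :: "nat \<Rightarrow> (nat \<Rightarrow> nat) \<Rightarrow> nat \<Rightarrow> bool" where
  "parks n a i \<longleftrightarrow> park_pos n a i \<le> n"

definition central :: "nat \<Rightarrow> (nat \<Rightarrow> nat) \<Rightarrow> nat set \<Rightarrow> bool" where
  "central n b S \<longleftrightarrow>
     S \<subseteq> {1..n} \<and>
     (\<exists>m (s :: nat \<Rightarrow> nat). S = s ` {1..m} \<and>
        (\<forall>j\<in>{1..m}. \<forall>l\<in>{1..m}. j < l \<longrightarrow> s j > s l) \<and>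
        (\<forall>j\<in>{1..m}. b (s j) \<le> j))"

text \<open>Greatest with respect to inclusion; it exists, see \<open>centre_eq_Union\<close> below.\<close>

definition centre :: "nat \<Rightarrow> (nat \<Rightarrow> nat) \<Rightarrow> nat set" where
  "centre n b = (GREATEST S. central n b S)"

definition tail_sorting :: "nat \<Rightarrow> nat \<Rightarrow> (nat \<Rightarrow> nat) \<Rightarrow> (nat \<Rightarrow> nat) \<Rightarrow> bool" where
  "tail_sorting n k a \<pi> \<longleftrightarrow>
     \<pi> permutes {1..n} \<and> (\<forall>i\<in>{1..n}. i < k \<longrightarrow> \<pi> i = i) \<and>
     (\<forall>i. k \<le> i \<and> i < n \<longrightarrow> a (\<pi> i) \<ge> a (\<pi> (i + 1)))"

text \<open>The choice of the permutation is immaterial, see \<open>tail_sorting_unique\<close> below.\<close>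

definition tail_sorted :: "nat \<Rightarrow> nat \<Rightarrow> (nat \<Rightarrow> nat) \<Rightarrow> nat \<Rightarrow> nat" where
  "tail_sorted n k a = a \<circ> (SOME \<pi>. tail_sorting n k a \<pi>)"

definition partial_parking_function :: "nat \<Rightarrow> nat \<Rightarrow> (nat \<Rightarrow> nat) \<Rightarrow> bool" where
  "partial_parking_function n k a \<longleftrightarrow>
     a \<in> {1..n} \<rightarrow>\<^sub>E {1..n} \<and> (\<forall>i\<in>{k..n}. parks n a i) \<and> 1 \<in> centre n (tail_sorted n k a)"

subsection \<open>Well-definedness\<close>

lemma hyperplane_eqD:
  assumes ij: "i \<in> {1..n}" "j \<in> {1..n}" "i \<noteq> j" and ij': "i' \<in> {1..n}" "j' \<in> {1..n}"
    and eq: "hyperplane n i j a = hyperplane n i' j' a'"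
  shows "a = a' \<and> (i = i' \<and> j = j' \<or> a = 0 \<and> (i' = j' \<or> i = j' \<and> j = i'))"
proof -
  have test: "f i' = f j' + real a'" if "f i = f j + real a" for f :: "nat \<Rightarrow> real"
  proof -
    have "restrict f {1..n} \<in> hyperplane n i j a"
      using that ij by (auto simp: hyperplane_def)
    then show ?thesis using ij' by (auto simp: eq) (auto simp: hyperplane_def)
  qed
  have test': "f i = f j + real a" if "f i' = f j' + real a'" for f :: "nat \<Rightarrow> real"
  proof -
    have "restrict f {1..n} \<in> hyperplane n i' j' a'"
      using that ij' by (auto simp: hyperplane_def)
    then show ?thesis using ij by (auto simp: eq [symmetric]) (auto simp: hyperplane_def)
  qed
  note t1 = test [of "\<lambda>l. if l = i then real a else 0"]
    and t2 = test [of "\<lambda>l. if l = j then - real a else 0"]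
    and t3 = test [of "\<lambda>l. if l = i then real j + real a else real l"]
  show ?thesis
  proof (cases "a = 0")
    case True
    then have "a' = 0" using test [of "\<lambda>_. 0"] by auto
    then show ?thesis using t3 True ij(3) by (auto split: if_splits)
  next
    case False
    then have "a' \<noteq> 0" using test' [of "\<lambda>_. 0"] by auto
    then show ?thesis using t1 t2 False ij(3) by (auto split: if_splits)
  qed
qed

lemma arc_ends_of_0:
  assumes "1 \<le> i" "i < j" "j \<le> n"
  shows "arc_ends_of n (hyperplane n i j 0) = (i, j)"
  unfolding arc_ends_of_def
proof (rule the_equality)
  show "\<exists>i'\<in>{1..n}. \<exists>j'\<in>{1..n}.
     (i' < j' \<and> hyperplane n i j 0 = hyperplane n i' j' 0 \<and> (i, j) = (i', j')) \<or>
     (\<exists>a\<ge>1. hyperplane n i j 0 = hyperplane n i' j' a \<and> (i, j) = (j', i'))"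
    using assms by (intro bexI [of _ i] bexI [of _ j]) auto
next
  fix e
  assume "\<exists>i'\<in>{1..n}. \<exists>j'\<in>{1..n}.
     (i' < j' \<and> hyperplane n i j 0 = hyperplane n i' j' 0 \<and> e = (i', j')) \<or>
     (\<exists>a'\<ge>1. hyperplane n i j 0 = hyperplane n i' j' a' \<and> e = (j', i'))"
  then obtain i' j' a' where *: "i' \<in> {1..n}" "j' \<in> {1..n}"
      "hyperplane n i j 0 = hyperplane n i' j' a'"
      "i' < j' \<and> a' = 0 \<and> e = (i', j') \<or> a' \<ge> 1 \<and> e = (j', i')"
    by blast
  show "e = (i, j)"
    using hyperplane_eqD [OF _ _ _ *(1-3)] *(4) assms by auto
qed

lemma arc_ends_of_pos:
  assumes "1 \<le> i" "i < j" "j \<le> n" "a \<ge> 1"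
  shows "arc_ends_of n (hyperplane n i j a) = (j, i)"
  unfolding arc_ends_of_def
proof (rule the_equality)
  show "\<exists>i'\<in>{1..n}. \<exists>j'\<in>{1..n}.
     (i' < j' \<and> hyperplane n i j a = hyperplane n i' j' 0 \<and> (j, i) = (i', j')) \<or>
     (\<exists>a'\<ge>1. hyperplane n i j a = hyperplane n i' j' a' \<and> (j, i) = (j', i'))"
    using assms by (intro bexI [of _ i] bexI [of _ j]) auto
next
  fix e
  assume "\<exists>i'\<in>{1..n}. \<exists>j'\<in>{1..n}.
     (i' < j' \<and> hyperplane n i j a = hyperplane n i' j' 0 \<and> e = (i', j')) \<or>
     (\<exists>a'\<ge>1. hyperplane n i j a = hyperplane n i' j' a' \<and> e = (j', i'))"
  then obtain i' j' a' where *: "i' \<in> {1..n}" "j' \<in> {1..n}"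
      "hyperplane n i j a = hyperplane n i' j' a'"
      "i' < j' \<and> a' = 0 \<and> e = (i', j') \<or> a' \<ge> 1 \<and> e = (j', i')"
    by blast
  show "e = (j, i)"
    using hyperplane_eqD [OF _ _ _ *(1-3)] *(4) assms by auto
qed

lemma finite_arrangement: "finite (arrangement n k)"
proof (rule finite_subset)
  show "arrangement n k \<subseteq>
    (\<lambda>(i, j, a). hyperplane n i j a) ` ({0..n+1} \<times> {0..n+1} \<times> {0..n+1})"
    by (fastforce simp: arrangement_def)
qed auto

lemma arrangement_arc_ends:
  assumes "H \<in> arrangement n k" "k \<ge> 1"
  obtains i j where "arc_ends_of n H = (i, j)" "i \<in> {1..n}" "j \<in> {1..n}" "i \<noteq> j"
proof -
  from assms consider
      i j where "H = hyperplane n i j 0" "1 \<le> i" "i < j" "j \<le> n"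
    | i j a where "H = hyperplane n i j a" "1 \<le> i" "i < j" "j \<le> n" "a \<ge> 1"
    unfolding arrangement_def by fastforce
  then show thesis
    by cases (use that arc_ends_of_0 arc_ends_of_pos in force)+
qed

lemma arr_graph_fin_loopfree:
  assumes "k \<ge> 1"
  shows "fin_digraph (arr_graph n k)" "loopfree_digraph (arr_graph n k)"
  using assms
  by (unfold_locales; auto simp: arr_graph_def finite_arrangement elim!: arrangement_arc_ends)+

lemma arr_graph_connected:
  assumes "n \<ge> 1"
  shows "Digraph_Component.connected (arr_graph n k)"
proof -
  let ?E = "parcs (mk_symmetric (arr_graph n k))"
  have arc: "(i, j) \<in> ?E \<and> (j, i) \<in> ?E" if "1 \<le> i" "i < j" "j \<le> n" for i j
  proof -
    have "hyperplane n i j 0 \<in> arcs (arr_graph n k)"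
      using that by (auto simp: arr_graph_def arrangement_def)
    then show ?thesis
      unfolding parcs_mk_symmetric
      using arc_ends_of_0 [OF that] by (fastforce simp: arr_graph_def)
  qed
  have "(u, v) \<in> rtrancl_on {1..n} ?E" if "u \<in> {1..n}" "v \<in> {1..n}" for u v
  proof (cases "u = v")
    case False
    then have "(u, v) \<in> ?E" using arc [of u v] arc [of v u] that by (cases "u < v") auto
    then show ?thesis using that by (meson rtrancl_on.simps)
  qed (use that in auto)
  then show ?thesis
    using assms
    by (auto simp: connected_def strongly_connected_def reachable_def arr_graph_def)
qed

lemma park_while:
  assumes "finite {p. spp p \<noteq> (0::nat)}"
  shows "while (\<lambda>p. spp p \<noteq> 0) Suc q = (LEAST p. q \<le> p \<and> spp p = 0)"
proof -
  let ?m = "LEAST p. q \<le> p \<and> spp p = 0"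
  obtain p where "q \<le> p" "spp p = 0"
    using assms infinite_Ici [of q] finite_subset [of "{q..}" "{p. spp p \<noteq> 0}"] by auto
  then have m: "q \<le> ?m \<and> spp ?m = 0"
    by (intro LeastI [of "\<lambda>p. q \<le> p \<and> spp p = 0" p]) auto
  show ?thesis
  proof (rule while_rule [where P = "\<lambda>p. q \<le> p \<and> p \<le> ?m" and r = "measure (\<lambda>p. ?m - p)"])
    fix s assume s: "q \<le> s \<and> s \<le> ?m" "spp s \<noteq> 0"
    then have "s \<noteq> ?m" using m by metis
    then show "q \<le> Suc s \<and> Suc s \<le> ?m" "(Suc s, s) \<in> measure (\<lambda>p. ?m - p)" using s by auto
  next
    fix s assume "q \<le> s \<and> s \<le> ?m" "\<not> spp s \<noteq> 0"
    then show "s = ?m" by (intro antisym Least_le) auto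
  qed (use m in auto)
qed

lemma central_iff:
  "central n b S \<longleftrightarrow> S \<subseteq> {1..n} \<and> (\<forall>i\<in>S. b i \<le> card {l \<in> S. i \<le> l})"
proof
  assume "central n b S"
  then obtain m and s :: "nat \<Rightarrow> nat" where S: "S \<subseteq> {1..n}" "S = s ` {1..m}"
    and dec: "\<forall>j\<in>{1..m}. \<forall>l\<in>{1..m}. j < l \<longrightarrow> s j > s l" and b: "\<forall>j\<in>{1..m}. b (s j) \<le> j"
    by (auto simp: central_def)
  have "b (s j) \<le> card {l \<in> S. s j \<le> l}" if j: "j \<in> {1..m}" for j
  proof -
    have inj: "inj_on s {1..m}"
      using dec by (intro inj_onI) (metis linorder_neqE_nat less_irrefl)
    have "s ` {1..j} \<subseteq> {l \<in> S. s j \<le> l}"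
      using dec j S by (force simp: le_less)
    then have "card (s ` {1..j}) \<le> card {l \<in> S. s j \<le> l}"
      by (rule card_mono [rotated]) (use S in auto)
    moreover have "card (s ` {1..j}) = j"
      using j by (subst card_image) (auto intro: inj_on_subset [OF inj])
    ultimately show ?thesis using bspec [OF b j] by linarith
  qed
  with S show "S \<subseteq> {1..n} \<and> (\<forall>i\<in>S. b i \<le> card {l \<in> S. i \<le> l})" by auto
next
  assume *: "S \<subseteq> {1..n} \<and> (\<forall>i\<in>S. b i \<le> card {l \<in> S. i \<le> l})"
  then have fin: "finite S" by (meson finite_atLeastAtMost finite_subset)
  define xs where "xs = rev (sorted_list_of_set S)"
  define s where "s j = xs ! (j - 1)" for j
  have xs: "sorted_wrt (>) xs" "set xs = S" "length xs = card S"
    using fin by (auto simp: xs_def sorted_wrt_rev)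
  have dec: "s j > s l" if "j \<in> {1..card S}" "l \<in> {1..card S}" "j < l" for j l
    using that xs by (auto simp: s_def sorted_wrt_iff_nth_less)
  have img: "S = s ` {1..card S}"
  proof -
    have "S = (\<lambda>j. xs ! j) ` {..<card S}" using xs by (auto simp: set_conv_nth)
    also have "{..<card S} = (\<lambda>j. j - 1) ` {1..card S}"
      by (force simp: image_iff intro: bexI [of _ "Suc _"])
    finally show ?thesis by (simp add: s_def image_image)
  qed
  have "b (s j) \<le> j" if j: "j \<in> {1..card S}" for j
  proof -
    have "s j \<in> S" using img j by blast
    then have "b (s j) \<le> card {l \<in> S. s j \<le> l}" using * by auto
    also have "{l \<in> S. s j \<le> l} \<subseteq> s ` {1..j}"
    proof
      fix x assume "x \<in> {l \<in> S. s j \<le> l}"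
      then have x: "x \<in> s ` {1..card S}" "s j \<le> x" using img by auto
      then obtain l where l: "x = s l" "l \<in> {1..card S}" "s j \<le> s l" by blast
      then have "l \<le> j" using dec [of j l] j by fastforce
      then show "x \<in> s ` {1..j}" using l by auto
    qed
    then have "card {l \<in> S. s j \<le> l} \<le> card (s ` {1..j})" by (intro card_mono) auto
    also have "\<dots> \<le> j" using card_image_le [of "{1..j}" s] by simp
    finally show ?thesis .
  qed
  then show "central n b S" unfolding central_def using * img dec by blast
qed

lemma central_Un:
  assumes "central n b S" "central n b T"
  shows "central n b (S \<union> T)"
proof -
  have fin: "finite S" "finite T"
    using assms by (meson central_iff finite_atLeastAtMost finite_subset)+
  then have "card {l \<in> S. i \<le> l} \<le> card {l \<in> S \<union> T. i \<le> l}"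
    "card {l \<in> T. i \<le> l} \<le> card {l \<in> S \<union> T. i \<le> l}" for i
    by (auto intro!: card_mono)
  then show ?thesis using assms unfolding central_iff by (meson Un_iff Un_least order_trans)
qed

lemma centre_eq_Union: "centre n b = \<Union>{S. central n b S}"
proof -
  have fin: "finite {S. central n b S}"
    by (rule finite_subset [of _ "Pow {1..n}"]) (auto simp: central_def)
  have "central n b (\<Union>F)" if "finite F" "F \<subseteq> {S. central n b S}" for F
    using that
  proof (induction F rule: finite_induct)
    case empty
    show ?case by (simp add: central_iff)
  next
    case (insert S F)
    then show ?case using central_Un by auto
  qed
  from this [OF fin] show ?thesis
    unfolding centre_def by (intro Greatest_equality) auto
qed

lemma tail_sorting_exists:
  assumes "k \<ge> 1"
  shows "\<exists>\<pi>. tail_sorting n k a \<pi>"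
proof -
  define ys where "ys = rev (sort_key a [k..<Suc n])"
  define \<pi> where "\<pi> i = (if i \<in> {k..n} then ys ! (i - k) else i)" for i
  have ys: "distinct ys" "set ys = {k..n}" "length ys = Suc n - k"
    by (auto simp: ys_def)
  have srt: "sorted_wrt (\<ge>) (map a ys)"
    by (simp add: ys_def rev_map [symmetric] sorted_wrt_rev)
  have "inj_on \<pi> {k..n}"
    using ys by (auto simp: \<pi>_def inj_on_def nth_eq_iff_index_eq)
  moreover have "\<pi> ` {k..n} \<subseteq> {k..n}"
  proof
    fix x assume "x \<in> \<pi> ` {k..n}"
    then obtain i where i: "i \<in> {k..n}" "x = ys ! (i - k)" by (auto simp: \<pi>_def)
    then have "x \<in> set ys" using ys(3) by auto
    then show "x \<in> {k..n}" using ys(2) by simp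
  qed
  ultimately have "bij_betw \<pi> {k..n} {k..n}"
    by (simp add: bij_betw_def endo_inj_surj)
  then have "\<pi> permutes {k..n}"
    by (rule bij_imp_permutes) (auto simp: \<pi>_def)
  then have "\<pi> permutes {1..n}"
    by (rule permutes_subset) (use assms in auto)
  moreover have "a (\<pi> i) \<ge> a (\<pi> (i + 1))" if "k \<le> i" "i < n" for i
    using sorted_wrt_nth_less [OF srt, of "i - k" "i + 1 - k"] that ys(3)
    by (auto simp: \<pi>_def)
  ultimately have "tail_sorting n k a \<pi>" by (auto simp: tail_sorting_def \<pi>_def)
  then show ?thesis by blast
qed

lemma tail_sorting_unique:
  assumes k: "k \<ge> 1" and p: "tail_sorting n k a \<pi>" and q: "tail_sorting n k a \<sigma>"
  shows "a \<circ> \<pi> = a \<circ> \<sigma>"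
proof -
  let ?l = "[k..<Suc n]"
  have srt: "sorted (rev (map (a \<circ> \<rho>) ?l))" if "tail_sorting n k a \<rho>" for \<rho>
  proof -
    have "sorted_wrt (\<ge>) (map (a \<circ> \<rho>) ?l)"
    proof (subst sorted_wrt_iff_nth_Suc_transp)
      show "\<forall>i. Suc i < length (map (a \<circ> \<rho>) ?l) \<longrightarrow>
              map (a \<circ> \<rho>) ?l ! i \<ge> map (a \<circ> \<rho>) ?l ! Suc i"
      proof (intro allI impI)
        fix i assume "Suc i < length (map (a \<circ> \<rho>) ?l)"
        then have i: "k + Suc i < Suc n" by (simp del: upt_Suc)
        then have "a (\<rho> (k + i)) \<ge> a (\<rho> (k + i + 1))"
          using that by (auto simp: tail_sorting_def)
        with i show "map (a \<circ> \<rho>) ?l ! i \<ge> map (a \<circ> \<rho>) ?l ! Suc i"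
          by (simp del: upt_Suc)
      qed
    qed (auto simp: transp_def)
    then show ?thesis by (simp add: sorted_wrt_rev del: upt_Suc)
  qed
  have mset: "mset (map (a \<circ> \<rho>) ?l) = image_mset a (mset ?l)" if "tail_sorting n k a \<rho>" for \<rho>
  proof -
    have \<rho>: "\<rho> permutes {1..n}" "\<And>i. 1 \<le> i \<Longrightarrow> i \<le> n \<Longrightarrow> i < k \<Longrightarrow> \<rho> i = i"
      using that by (auto simp: tail_sorting_def)
    have inj: "inj \<rho>" using \<rho>(1) by (rule permutes_inj)
    have "\<rho> ` {k..n} \<subseteq> {k..n}"
    proof
      fix x assume "x \<in> \<rho> ` {k..n}"
      then obtain i where i: "x = \<rho> i" "k \<le> i" "i \<le> n" by auto
      then have x: "x \<in> {1..n}" using permutes_in_image [OF \<rho>(1), of i] k by auto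
      have "\<not> x < k"
      proof
        assume "x < k"
        then have "\<rho> x = \<rho> i" using \<rho>(2) [of x] x i by auto
        then have "x = i" by (rule injD [OF inj])
        then show False using i \<open>x < k\<close> by simp
      qed
      with x show "x \<in> {k..n}" by auto
    qed
    then have "\<rho> ` {k..n} = {k..n}"
      by (rule endo_inj_surj [rotated]) (use inj_on_subset [OF inj] in auto)
    then have "set (map \<rho> ?l) = set ?l"
      by (simp add: atLeastLessThanSuc_atLeastAtMost del: upt_Suc)
    moreover have "distinct (map \<rho> ?l)"
      using inj_on_subset [OF inj] by (simp add: distinct_map del: upt_Suc)
    ultimately have "mset (map \<rho> ?l) = mset ?l"
      using set_eq_iff_mset_eq_distinct distinct_upt by blast
    then show ?thesis by (metis map_map mset_map)
  qed
  have "mset (rev (map (a \<circ> \<pi>) ?l)) = mset (rev (map (a \<circ> \<sigma>) ?l))"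
    unfolding mset_rev mset [OF p] mset [OF q] ..
  from properties_for_sort [OF this srt [OF p]]
  have "rev (map (a \<circ> \<pi>) ?l) = rev (map (a \<circ> \<sigma>) ?l)"
    using srt [OF q] by (simp only: sort_key_id_if_sorted sorted_sort_id)
  then have eq: "(a \<circ> \<pi>) i = (a \<circ> \<sigma>) i" if "k \<le> i" "i \<le> n" for i
    using that by (simp add: map_eq_conv del: upt_Suc)
  show ?thesis
  proof
    fix i
    show "(a \<circ> \<pi>) i = (a \<circ> \<sigma>) i"
    proof (cases "k \<le> i \<and> i \<le> n")
      case False
      then have "\<pi> i = i" "\<sigma> i = i"
        using p q permutes_not_in [of \<pi> "{1..n}" i] permutes_not_in [of \<sigma> "{1..n}" i]
        unfolding tail_sorting_def by (metis atLeastAtMost_iff not_le)+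
      then show ?thesis by simp
    qed (use eq in blast)
  qed
qed

end

theory Submission
  imports Defs
begin

text \<open>
  Dhar's burning algorithm decides whether \<open>a\<close> is a parking function of the graph. Before vertex \<open>1\<close>
  burns, a vertex \<open>i < k\<close> burns iff \<open>a i\<close> exceeds by at most one the number of burnt vertices above
  \<open>i\<close>, and the vertices \<open>i \<ge> k\<close> burn in the order of their values; this is the greedy construction
  of the centre, so vertex \<open>1\<close> burns iff it lies in the centre. Once it has burnt, the arcs to \<open>1\<close>
  let all of \<open>[k, n]\<close> burn iff these cars park, and then \<open>k - 1, \<dots>, 2\<close> burn because \<open>a i \<le> n\<close>.

  For the count, let \<open>z\<close> be the current size of the centre. Summing over one more coordinate below
  \<open>k\<close> multiplies the total weight \<open>z + 1\<close> by \<open>n + 1\<close>, and the number of choices for \<open>a 1\<close> is again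
  \<open>z + 1\<close>. Initially \<open>z + 1\<close> is the first free spot after parking the cars \<open>k, \<dots>, n\<close>, and by a
  circular rotation argument these spots sum to \<open>(n + 1) ^ (n - k + 1)\<close>.
\<close>

subsection \<open>First free spots and rotations\<close>

text \<open>The cars in \<open>K\<close> park on the spots \<open>1, \<dots>, n\<close>. The case \<open>a i = 0\<close> makes sense of this for
  preferences on the circle of spots modulo \<open>n + 1\<close>, where it says that spot \<open>0\<close> stays free.\<close>

definition parkable :: "nat \<Rightarrow> nat set \<Rightarrow> (nat \<Rightarrow> nat) \<Rightarrow> bool" where
  "parkable n K a \<longleftrightarrow> (\<forall>j\<le>n. card {i \<in> K. a i = 0 \<or> n - j < a i} \<le> j)"

text \<open>If the cars in \<open>K\<close> park with preferences \<open>a \<ge> 1\<close>, the first free spot is \<open>filled K a + 1\<close>.\<close>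

definition filled :: "nat set \<Rightarrow> (nat \<Rightarrow> nat) \<Rightarrow> nat" where
  "filled K a = (LEAST t. card {i \<in> K. a i \<le> Suc t} \<le> t)"

lemma card_filled_le:
  assumes "finite K"
  shows "card {i \<in> K. a i \<le> Suc (filled K a)} \<le> filled K a"
  unfolding filled_def
  by (rule LeastI [of "\<lambda>t. card {i \<in> K. a i \<le> Suc t} \<le> t" "card K"])
    (use assms in \<open>auto intro: card_mono\<close>)

lemma filled_le_card:
  assumes "finite K"
  shows "filled K a \<le> card K"
  unfolding filled_def by (rule Least_le) (use assms in \<open>auto intro: card_mono\<close>)

lemma le_card_if_le_filled:
  assumes "s \<le> filled K a"
  shows "s \<le> card {i \<in> K. a i \<le> s}"
proof (cases s)
  case (Suc t)
  then have "t < filled K a" using assms by simp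
  then have "\<not> card {i \<in> K. a i \<le> Suc t} \<le> t" unfolding filled_def by (rule not_less_Least)
  then show ?thesis using Suc by simp
qed simp

text \<open>Minimality already gives \<open>filled K a\<close> cars with values up to
  \<open>filled K a\<close>, so the bound in the definition is attained. Consequently no car prefers
  the spot \<open>Suc (filled K a)\<close>.\<close>

lemma card_filled:
  assumes "finite K"
  shows "card {i \<in> K. a i \<le> Suc (filled K a)} = filled K a"
proof (rule antisym [OF card_filled_le [OF assms]])
  have "filled K a \<le> card {i \<in> K. a i \<le> filled K a}" by (simp add: le_card_if_le_filled)
  also have "\<dots> \<le> card {i \<in> K. a i \<le> Suc (filled K a)}" by (rule card_mono) (use assms in auto)
  finally show "filled K a \<le> card {i \<in> K. a i \<le> Suc (filled K a)}" .
qed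

lemma le_filledI:
  assumes "finite K" and "\<And>s. s \<le> c \<Longrightarrow> s \<le> card {i \<in> K. a i \<le> s}"
  shows "c \<le> filled K a"
proof (rule ccontr)
  assume "\<not> c \<le> filled K a"
  then have "Suc (filled K a) \<le> card {i \<in> K. a i \<le> Suc (filled K a)}" using assms(2) by simp
  then show False using card_filled_le [OF assms(1), of a] by simp
qed

lemma parkable_cong:
  assumes "\<And>i. i \<in> K \<Longrightarrow> a i = b i"
  shows "parkable n K a \<longleftrightarrow> parkable n K b"
proof -
  have "{i \<in> K. a i = 0 \<or> n - j < a i} = {i \<in> K. b i = 0 \<or> n - j < b i}" for j
    using assms by auto
  then show ?thesis by (simp add: parkable_def)
qed

lemma filled_cong:
  assumes "\<And>i. i \<in> K \<Longrightarrow> a i = b i"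
  shows "filled K a = filled K b"
proof -
  have "{i \<in> K. a i \<le> Suc t} = {i \<in> K. b i \<le> Suc t}" for t
    using assms by auto
  then show ?thesis by (simp add: filled_def)
qed

text \<open>The rotation sends \<open>s\<close> to 0, values below \<open>s\<close> to the top of
  the circle and the others down by \<open>s\<close>. The cars to be counted for \<open>j\<close>
  thus come from an interval ending at \<open>s\<close>, bounded by \<open>before\<close>, or from
  one that wraps around past \<open>n\<close>, bounded by \<open>after\<close>.\<close>

lemma parkable_rotate:
  fixes g :: "nat \<Rightarrow> nat"
  assumes fin: "finite K" and g: "\<And>i. i \<in> K \<Longrightarrow> g i \<le> n" and "s \<le> n"
    and s: "card {i \<in> K. g i \<le> s} \<le> s"
    and before: "\<And>r. r < s \<Longrightarrow> card {i \<in> K. g i \<le> s} + r < card {i \<in> K. g i \<le> r} + s"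
    and after: "\<And>r. \<lbrakk>s \<le> r; r \<le> n\<rbrakk> \<Longrightarrow>
      card {i \<in> K. g i \<le> s} + card {i \<in> K. r < g i} \<le> n + s - r"
  shows "parkable n K (\<lambda>i. (g i + (n + 1) - s) mod (n + 1))"
  unfolding parkable_def
proof (intro allI impI)
  fix j assume j: "j \<le> n"
  define f where "f i = (g i + (n + 1) - s) mod (n + 1)" for i
  have f: "f i = (if s \<le> g i then g i - s else g i + (n + 1) - s)" if "i \<in> K" for i
  proof (cases "s \<le> g i")
    case True
    then have "g i + (n + 1) - s = (g i - s) + (n + 1)" by simp
    then have "f i = (g i - s) mod (n + 1)" unfolding f_def by (simp only: mod_add_self2)
    then show ?thesis using True g [OF that] by simp
  next
    case False
    then show ?thesis using \<open>s \<le> n\<close> by (simp add: f_def)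
  qed
  have "card {i \<in> K. f i = 0 \<or> n - j < f i} \<le> j"
  proof (cases "j < s")
    case True
    have "{i \<in> K. f i = 0 \<or> n - j < f i} \<subseteq> {i \<in> K. g i \<le> s} - {i \<in> K. g i \<le> s - j - 1}"
    proof
      fix i assume "i \<in> {i \<in> K. f i = 0 \<or> n - j < f i}"
      then show "i \<in> {i \<in> K. g i \<le> s} - {i \<in> K. g i \<le> s - j - 1}"
        using f [of i] g [of i] True \<open>s \<le> n\<close> by (auto split: if_splits)
    qed
    then have "card {i \<in> K. f i = 0 \<or> n - j < f i} \<le>
        card ({i \<in> K. g i \<le> s} - {i \<in> K. g i \<le> s - j - 1})"
      by (rule card_mono [rotated]) (use fin in auto)
    also have "\<dots> = card {i \<in> K. g i \<le> s} - card {i \<in> K. g i \<le> s - j - 1}"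
      by (rule card_Diff_subset) (use fin in auto)
    also have "\<dots> \<le> j" using before [of "s - j - 1"] True by linarith
    finally show ?thesis .
  next
    case False
    have "{i \<in> K. f i = 0 \<or> n - j < f i} \<subseteq> {i \<in> K. g i \<le> s} \<union> {i \<in> K. n + s - j < g i}"
    proof
      fix i assume "i \<in> {i \<in> K. f i = 0 \<or> n - j < f i}"
      then show "i \<in> {i \<in> K. g i \<le> s} \<union> {i \<in> K. n + s - j < g i}"
        using f [of i] g [of i] False j \<open>s \<le> n\<close> by (auto split: if_splits)
    qed
    then have "card {i \<in> K. f i = 0 \<or> n - j < f i} \<le>
        card ({i \<in> K. g i \<le> s} \<union> {i \<in> K. n + s - j < g i})"
      by (rule card_mono [rotated]) (use fin in auto)
    also have "\<dots> \<le> card {i \<in> K. g i \<le> s} + card {i \<in> K. n + s - j < g i}"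
      by (rule card_Un_le)
    also have "\<dots> \<le> j" using after [of "n + s - j"] False j by linarith
    finally show ?thesis .
  qed
  then show "card {i \<in> K. (g i + (n + 1) - s) mod (n + 1) = 0 \<or>
      n - j < (g i + (n + 1) - s) mod (n + 1)} \<le> j"
    by (simp add: f_def)
qed

text \<open>The spot to rotate to the origin is the leftmost minimum of
  \<open>s \<mapsto> card {i \<in> K. g i \<le> s} - s\<close>.\<close>

lemma ex_parkable_rotation:
  fixes g :: "nat \<Rightarrow> nat"
  assumes fin: "finite K" and g: "\<And>i. i \<in> K \<Longrightarrow> g i \<le> n" and K: "card K \<le> n"
  shows "\<exists>s\<le>n. parkable n K (\<lambda>i. (g i + (n + 1) - s) mod (n + 1))"
proof -
  define D where "D s = int (card {i \<in> K. g i \<le> s}) - int s" for s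
  define M where "M = Min (D ` {..n})"
  have M: "M \<le> D r" if "r \<le> n" for r using that by (auto simp: M_def)
  define s where "s = (LEAST s. s \<le> n \<and> D s = M)"
  have "M \<in> D ` {..n}" unfolding M_def by (rule Min_in) auto
  then have "\<exists>s. s \<le> n \<and> D s = M" by auto
  then have s: "s \<le> n" "D s = M" unfolding s_def by (metis (mono_tags, lifting) LeastI_ex)+
  \<comment> \<open>Being leftmost makes the inequality strict, as \<open>before\<close>
    requires.\<close>
  have lt: "M < D r" if "r < s" for r
    using not_less_Least [of r "\<lambda>s. s \<le> n \<and> D s = M"] that s M [of r] by (auto simp: s_def)
  have Dn: "D n \<le> 0"
    using K card_mono [OF fin, of "{i \<in> K. g i \<le> n}"] by (simp add: D_def)
  have "parkable n K (\<lambda>i. (g i + (n + 1) - s) mod (n + 1))"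
  proof (rule parkable_rotate)
    show "card {i \<in> K. g i \<le> s} \<le> s" using M [of n] Dn s by (simp add: D_def)
    show "card {i \<in> K. g i \<le> s} + r < card {i \<in> K. g i \<le> r} + s" if "r < s" for r
      using lt [OF that] s by (simp add: D_def)
    show "card {i \<in> K. g i \<le> s} + card {i \<in> K. r < g i} \<le> n + s - r" if "s \<le> r" "r \<le> n" for r
    proof -
      have "card K = card ({i \<in> K. g i \<le> r} \<union> {i \<in> K. r < g i})"
        by (rule arg_cong [of _ _ card]) auto
      also have "\<dots> = card {i \<in> K. g i \<le> r} + card {i \<in> K. r < g i}"
        by (rule card_Un_disjoint) (use fin in auto)
      finally show ?thesis using M [of r] s K that by (simp add: D_def)
    qed
  qed (use fin g s in auto)
  then show ?thesis using s by blast
qed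

text \<open>Pollak's circle argument: a preference function \<open>g\<close> modulo \<open>n + 1\<close> corresponds to the pair
  \<open>(f, c)\<close>, where \<open>c\<close> is the distance from spot \<open>0\<close> back to the nearest free spot and \<open>f = g + c\<close>
  is the rotation moving that spot to \<open>0\<close>.\<close>

lemma sum_filled_eq_power:
  assumes fin: "finite K" and K: "card K \<le> n"
  shows "(\<Sum>f | f \<in> K \<rightarrow>\<^sub>E {1..n} \<and> parkable n K f. filled K f + 1) = (n + 1) ^ card K"
proof -
  let ?N = "n + 1"
  define F where "F = {f. f \<in> K \<rightarrow>\<^sub>E {1..n} \<and> parkable n K f}"
  define rot where "rot = (\<lambda>(f, c). \<lambda>i\<in>K. (f i + ?N - c) mod ?N)"
  have finF: "finite F"
    by (rule finite_subset [of _ "K \<rightarrow>\<^sub>E {1..n}"]) (use fin in \<open>auto simp: F_def intro: finite_PiE\<close>)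
  have filled_le: "filled K f \<le> n" for f using filled_le_card [OF fin] K by (rule order_trans)
  have rot_ran: "rot p \<in> K \<rightarrow>\<^sub>E {..n}" for p
  proof -
    have "x mod ?N \<le> n" for x using mod_less_divisor [of ?N x] by linarith
    then show ?thesis by (auto simp: rot_def split: prod.splits)
  qed
  \<comment> \<open>If \<open>d = c' - c\<close> were positive, \<open>f\<close> would be
    \<open>f'\<close> rotated back by \<open>d\<close>. At least \<open>d\<close> cars have
    \<open>f' i \<le> d\<close>, and all of them wrap around to the last \<open>d - 1\<close> spots
    of \<open>f\<close>, where parkability leaves no room for them.\<close>
  have inj_aux: "c' \<le> c" if "f \<in> F" "f' \<in> F" "c' \<le> filled K f'" "rot (f, c) = rot (f', c')"
    for f f' c c'
  proof (rule ccontr)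
    assume c: "\<not> c' \<le> c"
    define d where "d = c' - c"
    have d: "d \<le> filled K f'" "1 \<le> d" "d \<le> n" "c \<le> n" "c' \<le> n"
      using c that filled_le [of f'] by (auto simp: d_def)
    have sub: "{i \<in> K. f' i \<le> d} \<subseteq> {i \<in> K. f i = 0 \<or> n - (d - 1) < f i}"
    proof
      fix i assume "i \<in> {i \<in> K. f' i \<le> d}"
      then have i: "i \<in> K" "f' i \<le> d" by auto
      have r: "f i \<in> {1..n}" "f' i \<in> {1..n}" using that i by (auto simp: F_def)
      have "rot (f, c) i = rot (f', c') i" using that(4) by simp
      then have "(f i + ?N - c) mod ?N = (f' i + ?N - c') mod ?N" using i by (simp add: rot_def)
      then have "(f i + ?N - c + c') mod ?N = (f' i + ?N - c' + c') mod ?N"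
        by (metis mod_add_left_eq)
      moreover have "f i + ?N - c + c' = (f i + d) + ?N" using d c by (simp add: d_def)
      moreover have "f' i + ?N - c' + c' = f' i + ?N" using d by simp
      ultimately have "(f i + d) mod ?N = f' i mod ?N" by (simp only: mod_add_self2)
      then have eq: "(f i + d) mod ?N = f' i" using r by simp
      have "f i + d > n"
      proof (rule ccontr)
        assume "\<not> f i + d > n"
        then have "f i + d = f' i" using eq by simp
        then show False using i r by simp
      qed
      moreover have "f i + d \<noteq> ?N" using eq r by auto
      ultimately show "i \<in> {i \<in> K. f i = 0 \<or> n - (d - 1) < f i}" using i d by auto
    qed
    have "d \<le> card {i \<in> K. f' i \<le> d}" using d by (simp add: le_card_if_le_filled)
    also have "\<dots> \<le> card {i \<in> K. f i = 0 \<or> n - (d - 1) < f i}"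
      by (rule card_mono [OF _ sub]) (use fin in auto)
    also have "\<dots> \<le> d - 1"
    proof -
      have "d - 1 \<le> n" using d by simp
      moreover have "parkable n K f" using that(1) by (simp add: F_def)
      ultimately show ?thesis unfolding parkable_def by blast
    qed
    finally show False using d by simp
  qed
  have "bij_betw rot (Sigma F (\<lambda>f. {..filled K f})) (K \<rightarrow>\<^sub>E {..n})"
  proof (rule bij_betwI')
    fix x y assume "x \<in> Sigma F (\<lambda>f. {..filled K f})" "y \<in> Sigma F (\<lambda>f. {..filled K f})"
    then obtain f c f' c' where xy: "x = (f, c)" "y = (f', c')" "f \<in> F" "f' \<in> F"
      "c \<le> filled K f" "c' \<le> filled K f'" by (cases x, cases y) auto
    show "rot x = rot y \<longleftrightarrow> x = y"
    proof
      assume eq: "rot x = rot y"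
      have cc: "c = c'"
        using inj_aux [of f f' c' c] inj_aux [of f' f c c'] eq xy by auto
      have "f = f'"
      proof (rule PiE_ext)
        show "f \<in> K \<rightarrow>\<^sub>E {1..n}" "f' \<in> K \<rightarrow>\<^sub>E {1..n}" using xy by (auto simp: F_def)
        fix i assume i: "i \<in> K"
        have r: "f i \<in> {1..n}" "f' i \<in> {1..n}" using xy i by (auto simp: F_def)
        have c: "c \<le> n" using xy filled_le [of f] by simp
        have "rot x i = rot y i" using eq by simp
        then have "(f i + ?N - c) mod ?N = (f' i + ?N - c) mod ?N"
          using i xy cc by (simp add: rot_def)
        then have "(f i + ?N - c + c) mod ?N = (f' i + ?N - c + c) mod ?N"
          by (metis mod_add_left_eq)
        moreover have "f i + ?N - c + c = f i + ?N" "f' i + ?N - c + c = f' i + ?N" using c by auto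
        ultimately have "f i mod ?N = f' i mod ?N" by (simp only: mod_add_self2)
        then show "f i = f' i" using r by simp
      qed
      then show "x = y" using xy cc by simp
    qed simp
  next
    fix x assume "x \<in> Sigma F (\<lambda>f. {..filled K f})"
    show "rot x \<in> K \<rightarrow>\<^sub>E {..n}" by (rule rot_ran)
  next
    fix g assume g: "g \<in> K \<rightarrow>\<^sub>E {..n}"
    then have g_le: "\<And>i. i \<in> K \<Longrightarrow> g i \<le> n" by auto
    define P where "P c \<longleftrightarrow> parkable n K (\<lambda>i. (g i + c) mod ?N)" for c
    obtain s where s: "s \<le> n" "parkable n K (\<lambda>i. (g i + ?N - s) mod ?N)"
      using ex_parkable_rotation [of K g n] fin g_le K by blast
    then have "P (?N - s)" unfolding P_def by (simp only: Nat.add_diff_assoc le_add1 trans_le_add1)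
    define c where "c = (LEAST c. P c)"
    have c: "P c" unfolding c_def by (rule LeastI) fact
    define f where "f = (\<lambda>i\<in>K. (g i + c) mod ?N)"
    have fpark: "parkable n K f"
      using c parkable_cong [of K f "\<lambda>i. (g i + c) mod ?N"] by (simp add: P_def f_def)
    \<comment> \<open>The instance \<open>j = 0\<close> of parkability excludes the value 0.\<close>
    then have "card {i \<in> K. f i = 0 \<or> n - 0 < f i} \<le> 0" unfolding parkable_def by blast
    then have none: "{i \<in> K. f i = 0 \<or> n - 0 < f i} = {}" using fin by simp
    have f_ran: "f i \<in> {1..n}" if "i \<in> K" for i
    proof (rule ccontr)
      assume "f i \<notin> {1..n}"
      then have "i \<in> {i \<in> K. f i = 0 \<or> n - 0 < f i}" using that by auto
      then show False using none by blast
    qed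
    then have fF: "f \<in> F" using fpark by (auto simp: F_def PiE_iff extensional_def f_def)
    \<comment> \<open>Otherwise take the first \<open>s \<le> c\<close> with fewer than
      \<open>s\<close> values up to \<open>s\<close>. It is at most \<open>n\<close>, since a full
      turn could else be removed from \<open>c\<close>. Rotating \<open>f\<close> back by
      \<open>s\<close> keeps it parkable, so \<open>c - s\<close> contradicts the minimality of
      \<open>c\<close>.\<close>
    have cf: "c \<le> filled K f"
    proof (rule ccontr)
      assume "\<not> c \<le> filled K f"
      then have ex: "\<exists>s. s \<le> c \<and> card {i \<in> K. f i \<le> s} < s"
        using le_filledI [OF fin, of c f] by (meson not_le)
      define s where "s = (LEAST s. s \<le> c \<and> card {i \<in> K. f i \<le> s} < s)"
      have s: "s \<le> c" "card {i \<in> K. f i \<le> s} < s"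
        using LeastI_ex [OF ex] by (auto simp: s_def)
      have below: "r \<le> card {i \<in> K. f i \<le> r}" if "r < s" for r
        using not_less_Least [of r "\<lambda>s. s \<le> c \<and> card {i \<in> K. f i \<le> s} < s"] that s
        by (auto simp: s_def)
      have "s \<le> n"
      proof (rule ccontr)
        assume "\<not> s \<le> n"
        define c' where "c' = c - ?N"
        have "c = c' + ?N" using \<open>\<not> s \<le> n\<close> s by (simp add: c'_def)
        then have "(g i + c) mod ?N = (g i + c') mod ?N" for i
          by (metis add.assoc mod_add_self2)
        then have "P c'" using c unfolding P_def by presburger
        then have "c \<le> c'" unfolding c_def by (rule Least_le)
        then show False using \<open>c = c' + ?N\<close> by simp
      qed
      have rotated: "parkable n K (\<lambda>i. (f i + ?N - s) mod ?N)"
      proof (rule parkable_rotate [OF fin _ \<open>s \<le> n\<close>])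
        show "card {i \<in> K. f i \<le> s} + r < card {i \<in> K. f i \<le> r} + s" if "r < s" for r
          using below [OF that] s by simp
        show "card {i \<in> K. f i \<le> s} + card {i \<in> K. r < f i} \<le> n + s - r" if "s \<le> r" "r \<le> n" for r
        proof -
          have "card {i \<in> K. r < f i} \<le> card {i \<in> K. f i = 0 \<or> n - (n - r) < f i}"
            by (rule card_mono) (use fin that in auto)
          also have "\<dots> \<le> n - r" using fpark unfolding parkable_def by simp
          finally show ?thesis using s that by simp
        qed
      qed (use s f_ran in auto)
      have eq: "(f i + ?N - s) mod ?N = (g i + (c - s)) mod ?N" if "i \<in> K" for i
      proof -
        have "(f i + ?N - s) mod ?N = ((g i + c) mod ?N + (?N - s)) mod ?N"
          using that \<open>s \<le> n\<close> by (simp add: f_def)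
        also have "\<dots> = (g i + c + (?N - s)) mod ?N" by (rule mod_add_left_eq)
        also have "g i + c + (?N - s) = (g i + (c - s)) + ?N" using s \<open>s \<le> n\<close> by simp
        finally show ?thesis by (simp only: mod_add_self2)
      qed
      have "P (c - s)"
        unfolding P_def by (rule iffD1 [OF parkable_cong [OF eq] rotated])
      then have "c \<le> c - s" unfolding c_def by (rule Least_le)
      then show False using s by simp
    qed
    have "g = rot (f, c)"
    proof (rule PiE_ext [OF g])
      show "rot (f, c) \<in> K \<rightarrow>\<^sub>E {..n}" by (rule rot_ran)
      fix i assume i: "i \<in> K"
      have "c \<le> n" using cf filled_le [of f] by simp
      then have "rot (f, c) i = ((g i + c) mod ?N + (?N - c)) mod ?N"
        using i by (simp add: rot_def f_def)
      also have "\<dots> = (g i + c + (?N - c)) mod ?N" by (rule mod_add_left_eq)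
      also have "g i + c + (?N - c) = g i + ?N" using \<open>c \<le> n\<close> by simp
      also have "(g i + ?N) mod ?N = g i" using g_le [OF i] by (simp only: mod_add_self2) simp
      finally show "g i = rot (f, c) i" ..
    qed
    moreover have "(f, c) \<in> Sigma F (\<lambda>f. {..filled K f})" using fF cf by simp
    ultimately show "\<exists>x\<in>Sigma F (\<lambda>f. {..filled K f}). g = rot x" by (rule bexI)
  qed
  then have "card (Sigma F (\<lambda>f. {..filled K f})) = card (K \<rightarrow>\<^sub>E {..n})" by (rule bij_betw_same_card)
  then show ?thesis using finF fin by (simp add: card_SigmaI card_PiE F_def)
qed

subsection \<open>The parking algorithm\<close>

text \<open>Invariant once the cars in \<open>P\<close> have arrived. The last conjunct records that
  no car skipped a free spot; it persists because spots are never vacated.\<close>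

definition parking_state ::
  "(nat \<Rightarrow> nat) \<Rightarrow> nat set \<Rightarrow> (nat \<Rightarrow> nat) \<times> (nat \<Rightarrow> nat) \<Rightarrow> bool" where
  "parking_state a P = (\<lambda>(spp, pp).
     finite P \<and> inj_on pp P \<and> pp ` P = {p. spp p \<noteq> 0} \<and>
     (\<forall>i\<in>P. a i \<le> pp i \<and> {a i..pp i} \<subseteq> pp ` P))"

lemma parking_state_step:
  assumes "parking_state a P st" and i: "i \<notin> P" "i \<noteq> 0"
  shows "parking_state a (insert i P) (park_step a i st)"
proof -
  obtain spp pp where st: "st = (spp, pp)" by (cases st)
  have P: "finite P" "inj_on pp P" "pp ` P = {p. spp p \<noteq> 0}"
    "\<And>i. i \<in> P \<Longrightarrow> a i \<le> pp i \<and> {a i..pp i} \<subseteq> pp ` P"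
    using assms(1) unfolding parking_state_def st by blast+
  have fin: "finite {p. spp p \<noteq> 0}" using P by (metis finite_imageI)
  define q where "q = (LEAST p. a i \<le> p \<and> spp p = 0)"
  obtain p where "a i \<le> p" "spp p = 0"
    using fin infinite_Ici [of "a i"] finite_subset [of "{a i..}" "{p. spp p \<noteq> 0}"] by auto
  then have q: "a i \<le> q" "spp q = 0"
    using LeastI [of "\<lambda>p. a i \<le> p \<and> spp p = 0" p] by (auto simp: q_def)
  have before_q: "spp p \<noteq> 0" if "a i \<le> p" "p < q" for p
    using not_less_Least [of p "\<lambda>p. a i \<le> p \<and> spp p = 0"] that by (auto simp: q_def)
  have step: "park_step a i st = (spp(q := i), pp(i := q))"
    by (simp only: park_step_def st q_def park_while [OF fin] Let_def prod.case)
  have img: "(pp(i := q)) ` insert i P = insert q (pp ` P)" using i by auto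
  have "q \<notin> pp ` P" using P q by auto
  then have "inj_on (pp(i := q)) (insert i P)"
    using P(2) i by (auto simp: inj_on_def)
  moreover have "insert q (pp ` P) = {p. (spp(q := i)) p \<noteq> 0}" using P(3) i by auto
  moreover have "a j \<le> (pp(i := q)) j \<and> {a j..(pp(i := q)) j} \<subseteq> insert q (pp ` P)"
    if "j \<in> insert i P" for j
  proof (cases "j = i")
    case True
    have "{a i..q} \<subseteq> insert q (pp ` P)"
      unfolding P(3)
    proof
      fix p assume "p \<in> {a i..q}"
      then show "p \<in> insert q {p. spp p \<noteq> 0}" using before_q [of p] by (cases "p = q") auto
    qed
    then show ?thesis using True q by simp
  next
    case False
    then show ?thesis using P(4) [of j] that by auto
  qed
  ultimately show ?thesis
    unfolding parking_state_def step prod.case img using P(1) by blast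
qed

lemma parking_state_fold:
  assumes "distinct xs" "0 \<notin> set xs"
  shows "parking_state a (set xs) (fold (park_step a) xs (\<lambda>_. 0, \<lambda>_. 0))"
  using assms
proof (induction xs rule: rev_induct)
  case Nil
  show ?case by (simp add: parking_state_def)
next
  case (snoc x xs)
  then have "parking_state a (insert x (set xs)) (park_step a x (fold (park_step a) xs (\<lambda>_. 0, \<lambda>_. 0)))"
    by (intro parking_state_step) auto
  then show ?case by simp
qed

text \<open>Lets the cars below \<open>k\<close> be ignored: they arrive last and do not move the
  others.\<close>

lemma snd_fold_park_step_notin:
  assumes "i \<notin> set xs"
  shows "snd (fold (park_step a) xs st) i = snd st i"
  using assms
proof (induction xs arbitrary: st)
  case (Cons x xs)
  then have "snd (fold (park_step a) (x # xs) st) i = snd (park_step a x st) i" by simp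
  also have "\<dots> = snd st i" using Cons.prems by (simp add: park_step_def Let_def split: prod.split)
  finally show ?case .
qed simp

text \<open>If some car overshoots, the maximal block of occupied spots reaching \<open>n + 1\<close> is filled
  entirely by cars that prefer spots in that block.\<close>

lemma parks_iff_parkable:
  assumes k: "1 \<le> k" and a: "\<And>i. i \<in> {k..n} \<Longrightarrow> a i \<in> {1..n}"
  shows "(\<forall>i\<in>{k..n}. parks n a i) \<longleftrightarrow> parkable n {k..n} a"
proof (cases "k \<le> n")
  case True
  define st where "st = fold (park_step a) (rev [k..<Suc n]) (\<lambda>_. 0, \<lambda>_. 0)"
  define pp where "pp = snd st"
  have "parking_state a (set (rev [k..<Suc n])) st"
    unfolding st_def by (rule parking_state_fold) (use k in auto)
  moreover have "set (rev [k..<Suc n]) = {k..n}" by auto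
  ultimately have "parking_state a {k..n} (fst st, pp)" by (simp only: pp_def prod.collapse)
  then have P: "inj_on pp {k..n}"
    "\<And>i. i \<in> {k..n} \<Longrightarrow> a i \<le> pp i \<and> {a i..pp i} \<subseteq> pp ` {k..n}"
    unfolding parking_state_def by blast+
  have "[1..<Suc n] = [1..<k] @ [k..<Suc n]"
    using upt_add_eq_append [of 1 k "Suc n - k"] k True by (simp del: upt_Suc)
  then have "park_pos n a = snd (fold (park_step a) (rev [1..<k]) st)"
    unfolding park_pos_def st_def by (simp del: upt_Suc)
  then have pos: "park_pos n a i = pp i" if "i \<in> {k..n}" for i
    using snd_fold_park_step_notin [of i "rev [1..<k]"] that by (simp add: pp_def)
  have "(\<forall>i\<in>{k..n}. pp i \<le> n) \<longleftrightarrow> parkable n {k..n} a"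
  proof
    assume le: "\<forall>i\<in>{k..n}. pp i \<le> n"
    show "parkable n {k..n} a"
      unfolding parkable_def
    proof (intro allI impI)
      fix j assume "j \<le> n"
      let ?S = "{i \<in> {k..n}. a i = 0 \<or> n - j < a i}"
      have "card ?S = card (pp ` ?S)"
        by (rule card_image [symmetric], rule inj_on_subset [OF P(1)]) auto
      also have "\<dots> \<le> card {n - j<..n}"
      proof (rule card_mono)
        show "pp ` ?S \<subseteq> {n - j<..n}" using le P(2) a by fastforce
      qed simp
      also have "\<dots> = j" using \<open>j \<le> n\<close> by simp
      finally show "card ?S \<le> j" .
    qed
  next
    assume park: "parkable n {k..n} a"
    show "\<forall>i\<in>{k..n}. pp i \<le> n"
    proof (rule ccontr)
      assume "\<not> (\<forall>i\<in>{k..n}. pp i \<le> n)"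
      then obtain i where i: "i \<in> {k..n}" "n < pp i" by auto
      let ?Q = "\<lambda>p. p \<le> n \<and> {p..n + 1} \<subseteq> pp ` {k..n}"
      define q where "q = (LEAST p. ?Q p)"
      have "{a i..n + 1} \<subseteq> pp ` {k..n}" using P(2) [OF i(1)] i(2) by fastforce
      then have "?Q (a i)" using a [OF i(1)] by simp
      then have q: "?Q q" unfolding q_def by (rule LeastI)
      let ?S = "{l \<in> {k..n}. q \<le> a l}"
      have "q \<in> pp ` {k..n}" using q by auto
      have q_pos: "1 \<le> q"
      proof -
        from \<open>q \<in> pp ` {k..n}\<close> obtain l where "l \<in> {k..n}" "q = pp l" by blast
        then show ?thesis using P(2) [of l] a [of l] by auto
      qed
      \<comment> \<open>A car of the block preferring a spot before \<open>q\<close> would force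
        \<open>q - 1\<close> to be occupied, against the choice of \<open>q\<close>. So
        \<open>n + 2 - q\<close> cars have values at least \<open>q\<close>, one more than
        parkability allows.\<close>
      have "{q..n + 1} \<subseteq> pp ` ?S"
      proof
        fix p assume p: "p \<in> {q..n + 1}"
        then obtain l where l: "l \<in> {k..n}" "p = pp l" using q by blast
        have "q \<le> a l"
        proof (rule ccontr)
          assume "\<not> q \<le> a l"
          then have "q - 1 \<in> {a l..pp l}" using p l by auto
          then have "q - 1 \<in> pp ` {k..n}" using P(2) [OF l(1)] by blast
          moreover have "{q - 1..n + 1} = insert (q - 1) {q..n + 1}" using q q_pos by auto
          ultimately have "?Q (q - 1)" using q by auto
          then have "q \<le> q - 1" unfolding q_def by (rule Least_le)
          then show False using q_pos by simp
        qed
        then show "p \<in> pp ` ?S" using l by blast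
      qed
      then have "card {q..n + 1} \<le> card (pp ` ?S)" by (intro card_mono) auto
      also have "\<dots> \<le> card ?S" by (rule card_image_le) simp
      also have "?S = {l \<in> {k..n}. a l = 0 \<or> n - (n + 1 - q) < a l}"
        using q_pos q a by fastforce
      also have "card \<dots> \<le> n + 1 - q"
      proof -
        have "n + 1 - q \<le> n" using q_pos by simp
        then show ?thesis using park unfolding parkable_def by blast
      qed
      finally show False using q by simp
    qed
  qed
  then show ?thesis using pos by (simp add: parks_def)
qed (simp add: parkable_def)

subsection \<open>The centre\<close>

lemma central_centre: "central n b (centre n b)"
proof -
  have fin: "finite {S. central n b S}"
    by (rule finite_subset [of _ "Pow {1..n}"]) (auto simp: central_def)
  have "central n b (\<Union>F)" if "finite F" "F \<subseteq> {S. central n b S}" for F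
    using that by (induction F rule: finite_induct) (auto simp: central_iff [of n b "{}"] central_Un)
  then show ?thesis using fin by (simp add: centre_eq_Union)
qed

lemma centre_subset: "centre n b \<subseteq> {1..n}"
  using central_centre by (simp add: central_iff)

lemma finite_centre: "finite (centre n b)"
  using centre_subset by (rule finite_subset) simp

text \<open>Inserting \<open>i\<close> can only raise the counts of the other members, so by
  maximality \<open>i\<close> belongs to the centre as soon as its own condition holds. Read from
  \<open>n\<close> downwards, this determines the centre greedily.\<close>

lemma mem_centre_iff:
  assumes i: "i \<in> {1..n}"
  shows "i \<in> centre n b \<longleftrightarrow> b i \<le> Suc (card (centre n b \<inter> {i<..n}))"
proof -
  let ?Z = "centre n b"
  have Z: "?Z \<subseteq> {1..n}" "\<And>l. l \<in> ?Z \<Longrightarrow> b l \<le> card {m \<in> ?Z. l \<le> m}"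
    using central_centre [of n b] by (auto simp: central_iff)
  have above: "{l \<in> insert i ?Z. i \<le> l} = insert i (?Z \<inter> {i<..n})" using Z i by auto
  show ?thesis
  proof
    assume "i \<in> ?Z"
    then have "b i \<le> card {l \<in> insert i ?Z. i \<le> l}" using Z(2) [of i] by (simp add: insert_absorb)
    then show "b i \<le> Suc (card (?Z \<inter> {i<..n}))" unfolding above by simp
  next
    assume b: "b i \<le> Suc (card (?Z \<inter> {i<..n}))"
    have "b l \<le> card {m \<in> insert i ?Z. l \<le> m}" if "l \<in> insert i ?Z" for l
    proof (cases "l = i")
      case True
      have "b i \<le> card {m \<in> insert i ?Z. i \<le> m}" unfolding above using b by simp
      then show ?thesis using True by simp
    next
      case False
      then have "b l \<le> card {m \<in> ?Z. l \<le> m}" using Z(2) that by simp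
      also have "\<dots> \<le> card {m \<in> insert i ?Z. l \<le> m}"
        by (rule card_mono) (auto simp: finite_centre)
      finally show ?thesis .
    qed
    then have "central n b (insert i ?Z)" using Z i by (auto simp: central_iff)
    then show "i \<in> ?Z" by (auto simp: centre_eq_Union)
  qed
qed

text \<open>The size of the centre, counted through the indices \<open>m, m - 1, \<dots>, m - d + 1\<close> from the initial
  count \<open>z\<close>.\<close>

primrec greedy :: "(nat \<Rightarrow> nat) \<Rightarrow> nat \<Rightarrow> nat \<Rightarrow> nat \<Rightarrow> nat" where
  "greedy a m z 0 = z"
| "greedy a m z (Suc d) =
     (if a (m - d) \<le> Suc (greedy a m z d) then Suc (greedy a m z d) else greedy a m z d)"

lemma greedy_cong:
  assumes "\<And>i. i \<in> {m - d<..m} \<Longrightarrow> a i = b i" "d \<le> m"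
  shows "greedy a m z d = greedy b m z d"
  using assms
proof (induction d)
  case (Suc d)
  have "greedy a m z d = greedy b m z d" by (rule Suc.IH) (use Suc.prems in auto)
  moreover have "a (m - d) = b (m - d)" using Suc.prems by simp
  ultimately show ?case by simp
qed simp

lemma greedy_le: "greedy a m z d \<le> z + d"
  by (induction d) auto

lemma card_centre_greedy:
  assumes "d \<le> m" "m \<le> n"
  shows "card (centre n b \<inter> {m - d<..n}) = greedy b m (card (centre n b \<inter> {m<..n})) d"
  using assms
proof (induction d)
  case (Suc d)
  let ?Z = "centre n b"
  have split: "{m - Suc d<..n} = insert (m - d) {m - d<..n}" using Suc.prems by auto
  have mem: "m - d \<in> ?Z \<longleftrightarrow> b (m - d) \<le> Suc (card (?Z \<inter> {m - d<..n}))"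
    by (rule mem_centre_iff) (use Suc.prems in auto)
  have IH: "card (?Z \<inter> {m - d<..n}) = greedy b m (card (?Z \<inter> {m<..n})) d"
    using Suc by simp
  show ?case
    unfolding split using mem IH by (simp add: Int_insert_right finite_centre)
qed simp

section \<open>The centre on the sorted tail\<close>

lemma tail_sorting_tail_sorted:
  assumes "1 \<le> k"
  obtains \<pi> where "tail_sorting n k a \<pi>" "tail_sorted n k a = a \<circ> \<pi>"
proof
  show "tail_sorting n k a (SOME \<pi>. tail_sorting n k a \<pi>)"
    by (rule someI_ex [OF tail_sorting_exists [OF assms]])
qed (simp add: tail_sorted_def)

lemma tail_sorted_below:
  assumes "1 \<le> k" "i \<in> {1..n}" "i < k"
  shows "tail_sorted n k a i = a i"
proof -
  obtain \<pi> where "tail_sorting n k a \<pi>" "tail_sorted n k a = a \<circ> \<pi>"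
    using tail_sorting_tail_sorted [OF assms(1)] .
  then show ?thesis using assms by (simp add: tail_sorting_def)
qed

lemma tail_sorting_image:
  assumes k: "1 \<le> k" and \<pi>: "tail_sorting n k a \<pi>"
  shows "\<pi> ` {k..n} = {k..n}"
proof (cases "k \<le> n")
  case True
  have p: "\<pi> permutes {1..n}" and id: "\<And>i. i \<in> {1..<k} \<Longrightarrow> \<pi> i = i"
    using \<pi> True by (auto simp: tail_sorting_def)
  have "{k..n} = {1..n} - {1..<k}" using k by auto
  then have "\<pi> ` {k..n} = \<pi> ` {1..n} - \<pi> ` {1..<k}"
    using permutes_inj [OF p] by (simp add: image_set_diff)
  also have "\<dots> = {1..n} - {1..<k}" using permutes_image [OF p] id by simp
  also have "\<dots> = {k..n}" using k by auto
  finally show ?thesis .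
qed simp

lemma tail_sorted_antimono:
  assumes "1 \<le> k" "k \<le> i" "i \<le> j" "j \<le> n"
  shows "tail_sorted n k a j \<le> tail_sorted n k a i"
proof -
  obtain \<pi> where \<pi>: "tail_sorting n k a \<pi>" "tail_sorted n k a = a \<circ> \<pi>"
    using tail_sorting_tail_sorted [OF assms(1)] .
  have dec: "tail_sorted n k a (Suc l) \<le> tail_sorted n k a l" if "k \<le> l" "l < n" for l
    using \<pi> that by (simp add: tail_sorting_def)
  show ?thesis using assms(3,4)
  proof (induction j rule: dec_induct)
    case (step j)
    then show ?case using \<open>k \<le> i\<close> dec [of j] by simp
  qed simp
qed

text \<open>\<open>filled\<close> depends only on these counts, so it may be computed on the sorted
  tail.\<close>

lemma card_tail_sorted:
  assumes "1 \<le> k"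
  shows "card {i \<in> {k..n}. tail_sorted n k a i \<le> s} = card {i \<in> {k..n}. a i \<le> s}"
proof -
  obtain \<pi> where \<pi>: "tail_sorting n k a \<pi>" "tail_sorted n k a = a \<circ> \<pi>"
    using tail_sorting_tail_sorted [OF assms] .
  have inj: "inj \<pi>" using \<pi> permutes_inj by (auto simp: tail_sorting_def)
  have "{i \<in> {k..n}. a i \<le> s} = {i \<in> \<pi> ` {k..n}. a i \<le> s}"
    by (simp add: tail_sorting_image [OF assms \<pi>(1)])
  also have "\<dots> = \<pi> ` {i \<in> {k..n}. tail_sorted n k a i \<le> s}" using \<pi>(2) by auto
  finally show ?thesis using card_image [OF inj_on_subset [OF inj subset_UNIV]] by metis
qed

text \<open>In a decreasing tail the values up to \<open>t + 1\<close> occupy a final segment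
  \<open>U\<close>, of size \<open>t\<close> by \<open>card_filled\<close>. Descending induction
  shows that the centre meets \<open>{k..n}\<close> exactly in \<open>U\<close>.\<close>

lemma card_centre_tail_sorted:
  assumes k: "1 \<le> k"
  shows "card (centre n (tail_sorted n k a) \<inter> {k..n}) = filled {k..n} a"
proof -
  define b where "b = tail_sorted n k a"
  define t where "t = filled {k..n} b"
  have t: "t = filled {k..n} a" by (simp only: t_def b_def filled_def card_tail_sorted [OF k])
  define U where "U = {i \<in> {k..n}. b i \<le> Suc t}"
  have card_U: "card U = t" unfolding U_def t_def by (rule card_filled) simp
  have anti: "b j \<le> b i" if "k \<le> i" "i \<le> j" "j \<le> n" for i j
    unfolding b_def using tail_sorted_antimono [OF k that] .
  have up: "{i..n} \<subseteq> {l \<in> {k..n}. b l \<le> s}" if "k \<le> i" "b i \<le> s" for i s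
    using that anti by fastforce
  have mem: "i \<in> centre n b \<longleftrightarrow> i \<in> U" if "i \<in> {k..n}" for i
    using that
  proof (induction "n - i" arbitrary: i rule: less_induct)
    case less
    have above: "centre n b \<inter> {i<..n} = U \<inter> {i<..n}"
    proof (rule set_eqI)
      fix l
      show "l \<in> centre n b \<inter> {i<..n} \<longleftrightarrow> l \<in> U \<inter> {i<..n}"
        using less.hyps [of l] less.prems by auto
    qed
    have iff: "i \<in> centre n b \<longleftrightarrow> b i \<le> Suc (card (U \<inter> {i<..n}))"
      unfolding above [symmetric] by (rule mem_centre_iff) (use less.prems k in auto)
    show ?case
    proof
      assume "i \<in> centre n b"
      then have "b i \<le> Suc (card (U \<inter> {i<..n}))" using iff by simp
      also have "card (U \<inter> {i<..n}) \<le> card U" by (rule card_mono) (auto simp: U_def)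
      finally show "i \<in> U" using less.prems card_U by (simp add: U_def)
    next
      assume "i \<in> U"
      then have sub: "{i..n} \<subseteq> U" using up [of i "Suc t"] less.prems by (simp add: U_def)
      then have "card {i..n} \<le> t" using card_mono [OF _ sub] card_U by (simp add: U_def)
      then have r: "Suc (n - i) \<le> t" using less.prems by (simp add: Suc_diff_le)
      \<comment> \<open>Otherwise all values up to \<open>Suc (n - i)\<close> sit at the
        \<open>n - i\<close> positions after \<open>i\<close>, although
        \<open>Suc (n - i) \<le> t\<close> guarantees one more of them.\<close>
      have "b i \<le> Suc (n - i)"
      proof (rule ccontr)
        assume large: "\<not> b i \<le> Suc (n - i)"
        have "{l \<in> {k..n}. b l \<le> Suc (n - i)} \<subseteq> {i<..n}"
        proof
          fix l assume l: "l \<in> {l \<in> {k..n}. b l \<le> Suc (n - i)}"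
          show "l \<in> {i<..n}"
          proof (rule ccontr)
            assume "l \<notin> {i<..n}"
            then have "b i \<le> b l" using anti [of l i] l less.prems by auto
            then show False using l large by simp
          qed
        qed
        then have "card {l \<in> {k..n}. b l \<le> Suc (n - i)} \<le> n - i"
          using card_mono [of "{i<..n}"] by fastforce
        moreover have "Suc (n - i) \<le> card {l \<in> {k..n}. b l \<le> Suc (n - i)}"
          using r unfolding t_def by (rule le_card_if_le_filled)
        ultimately show False by simp
      qed
      moreover have "U \<inter> {i<..n} = {i<..n}" using sub by auto
      ultimately show "i \<in> centre n b" using iff by simp
    qed
  qed
  have "centre n b \<inter> {k..n} = U"
  proof (rule set_eqI)
    fix i
    show "i \<in> centre n b \<inter> {k..n} \<longleftrightarrow> i \<in> U" using mem [of i] by (auto simp: U_def)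
  qed
  then show ?thesis using card_U t by (simp add: b_def)
qed

lemma partial_parking_function_iff_centre:
  assumes "1 \<le> k"
  shows "partial_parking_function n k a \<longleftrightarrow>
    a \<in> {1..n} \<rightarrow>\<^sub>E {1..n} \<and> parkable n {k..n} a \<and> 1 \<in> centre n (tail_sorted n k a)"
proof (cases "a \<in> {1..n} \<rightarrow>\<^sub>E {1..n}")
  case True
  then have "\<And>i. i \<in> {k..n} \<Longrightarrow> a i \<in> {1..n}" using assms by fastforce
  from parks_iff_parkable [OF assms this] show ?thesis by (simp add: partial_parking_function_def)
qed (simp add: partial_parking_function_def)

text \<open>Index 1 is decided last: the sorted tail contributes \<open>filled {k..n} a\<close>, and
  the \<open>k - 2\<close> indices from \<open>k - 1\<close> down to 2 are processed by
  \<open>greedy\<close>. This eliminates the sorting permutation.\<close>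

lemma partial_parking_function_iff_greedy:
  assumes "2 \<le> k" "k \<le> n"
  shows "partial_parking_function n k a \<longleftrightarrow>
    a \<in> {1..n} \<rightarrow>\<^sub>E {1..n} \<and> parkable n {k..n} a \<and>
    a 1 \<le> Suc (greedy a (k - 1) (filled {k..n} a) (k - 2))"
proof -
  let ?b = "tail_sorted n k a"
  have "1 \<in> centre n ?b \<longleftrightarrow> ?b 1 \<le> Suc (card (centre n ?b \<inter> {1<..n}))"
    by (rule mem_centre_iff) (use assms in auto)
  also have "?b 1 = a 1" by (rule tail_sorted_below) (use assms in auto)
  also have "card (centre n ?b \<inter> {1<..n}) =
      greedy ?b (k - 1) (card (centre n ?b \<inter> {k - 1<..n})) (k - 2)"
  proof -
    have "k - 1 - (k - 2) = 1" using assms by simp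
    then show ?thesis using card_centre_greedy [of "k - 2" "k - 1" n ?b] assms by simp
  qed
  also have "{k - 1<..n} = {k..n}" using assms by auto
  also have "card (centre n ?b \<inter> {k..n}) = filled {k..n} a"
    by (rule card_centre_tail_sorted) (use assms in auto)
  also have "greedy ?b (k - 1) (filled {k..n} a) (k - 2) =
      greedy a (k - 1) (filled {k..n} a) (k - 2)"
    by (rule greedy_cong) (use assms in \<open>auto intro!: tail_sorted_below\<close>)
  finally show ?thesis using assms by (simp add: partial_parking_function_iff_centre)
qed

subsection \<open>Counting partial parking functions\<close>

lemma sum_PiE_insert:
  assumes "x \<notin> S"
  shows "(\<Sum>f\<in>PiE (insert x S) T. h f) = (\<Sum>g\<in>PiE S T. \<Sum>y\<in>T x. h (g(x := y)))"
proof -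
  have "(\<Sum>f\<in>PiE (insert x S) T. h f) = (\<Sum>(y, g)\<in>T x \<times> PiE S T. h (g(x := y)))"
    unfolding PiE_insert_eq using inj_combinator [OF assms, of T]
    by (simp add: sum.reindex case_prod_unfold)
  also have "\<dots> = (\<Sum>y\<in>T x. \<Sum>g\<in>PiE S T. h (g(x := y)))"
    by (rule sum.cartesian_product [symmetric])
  also have "\<dots> = (\<Sum>g\<in>PiE S T. \<Sum>y\<in>T x. h (g(x := y)))" by (rule sum.swap)
  finally show ?thesis .
qed

text \<open>With the value of one more coordinate summed over \<open>[n]\<close>, the weight \<open>z + 1\<close> becomes
  \<open>(z + 1) (z + 2) + (n - z - 1) (z + 1) = (n + 1) (z + 1)\<close>.\<close>

lemma sum_greedy_step:
  fixes n z :: nat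
  assumes "Suc z \<le> n"
  shows "(\<Sum>y\<in>{1..n}. (if y \<le> Suc z then Suc z else z) + 1) = (n + 1) * (z + 1)"
proof -
  have "(\<Sum>y\<in>{1..n}. (if y \<le> Suc z then Suc z else z) + 1) =
      (\<Sum>y\<in>{1..n}. (z + 1) + (if y \<le> Suc z then 1 else 0))"
    by (rule sum.cong) auto
  also have "\<dots> = n * (z + 1) + card ({1..n} \<inter> {y. y \<le> Suc z})"
    by (subst sum.distrib) (simp add: sum.If_cases)
  also have "{1..n} \<inter> {y. y \<le> Suc z} = {1..Suc z}" using assms by auto
  finally show ?thesis by (simp add: algebra_simps)
qed

text \<open>The base case is the circle argument. A further coordinate below \<open>k\<close>
  affects neither parkability nor \<open>filled\<close>, and summing over it contributes a factor
  \<open>n + 1\<close> by \<open>sum_greedy_step\<close>.\<close>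

lemma sum_greedy:
  assumes "d < k" "k \<le> n" "1 \<le> k"
  shows "(\<Sum>a\<in>{k - d..n} \<rightarrow>\<^sub>E {1..n}.
      if parkable n {k..n} a then greedy a (k - 1) (filled {k..n} a) d + 1 else 0) =
    (n + 1) ^ (n + 1 - k + d)"
  using assms(1)
proof (induction d)
  case 0
  let ?A = "{k..n} \<rightarrow>\<^sub>E {1..n}"
  have "(\<Sum>a\<in>?A. if parkable n {k..n} a then filled {k..n} a + 1 else 0) =
      (\<Sum>a | a \<in> ?A \<and> parkable n {k..n} a. filled {k..n} a + 1)"
    by (rule sum.inter_filter [symmetric]) (auto intro: finite_PiE)
  also have "\<dots> = (n + 1) ^ card {k..n}" by (rule sum_filled_eq_power) (use assms in auto)
  finally show ?case by (simp cong: if_cong)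
next
  case (Suc d)
  let ?x = "k - Suc d"
  have ins: "{k - Suc d..n} = insert ?x {k - d..n}" using Suc.prems assms by auto
  have x: "?x \<notin> {k - d..n}" "?x \<notin> {k..n}" using Suc.prems by auto
  let ?h = "\<lambda>d a. if parkable n {k..n} a then greedy a (k - 1) (filled {k..n} a) d + 1 else 0"
  have "(\<Sum>a\<in>{k - Suc d..n} \<rightarrow>\<^sub>E {1..n}. ?h (Suc d) a) =
      (\<Sum>g\<in>{k - d..n} \<rightarrow>\<^sub>E {1..n}. \<Sum>y\<in>{1..n}. ?h (Suc d) (g(?x := y)))"
    unfolding ins by (rule sum_PiE_insert [OF x(1)])
  also have "\<dots> = (\<Sum>g\<in>{k - d..n} \<rightarrow>\<^sub>E {1..n}. (n + 1) * ?h d g)"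
  proof (rule sum.cong [OF refl])
    fix g
    define z where "z = greedy g (k - 1) (filled {k..n} g) d"
    have park: "parkable n {k..n} (g(?x := y)) = parkable n {k..n} g" for y
      by (rule parkable_cong) (use x in auto)
    have fill: "filled {k..n} (g(?x := y)) = filled {k..n} g" for y
      by (rule filled_cong) (use x in auto)
    have gr: "greedy (g(?x := y)) (k - 1) (filled {k..n} g) d = z" for y
      unfolding z_def by (rule greedy_cong) (use Suc.prems in auto)
    \<comment> \<open>\<open>Suc d < Suc k\<close> alone would be too weak: the bound
      \<open>Suc d < k\<close> keeps the threshold \<open>Suc z\<close> inside
      \<open>{1..n}\<close>.\<close>
    have "z \<le> filled {k..n} g + d" unfolding z_def by (rule greedy_le)
    moreover have "filled {k..n} g \<le> n + 1 - k" using filled_le_card [of "{k..n}" g] by simp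
    ultimately have z: "Suc z \<le> n" using Suc.prems assms by linarith
    have upd: "(g(?x := y)) (k - 1 - d) = y" for y by simp
    have "(\<Sum>y\<in>{1..n}. ?h (Suc d) (g(?x := y))) =
        (if parkable n {k..n} g then \<Sum>y\<in>{1..n}. (if y \<le> Suc z then Suc z else z) + 1 else 0)"
      unfolding greedy.simps park fill gr upd by simp
    also have "\<dots> = (n + 1) * ?h d g" by (simp only: sum_greedy_step [OF z]) (simp add: z_def)
    finally show "(\<Sum>y\<in>{1..n}. ?h (Suc d) (g(?x := y))) = (n + 1) * ?h d g" .
  qed
  also have "\<dots> = (n + 1) * (n + 1) ^ (n + 1 - k + d)"
    unfolding sum_distrib_left [symmetric] using Suc by simp
  finally show ?case by simp
qed

lemma card_partial_parking_functions:
  assumes "2 \<le> k" "k \<le> n"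
  shows "card {a. partial_parking_function n k a} = (n + 1) ^ (n - 1)"
proof -
  let ?z = "\<lambda>a. greedy a (k - 1) (filled {k..n} a) (k - 2)"
  let ?P = "\<lambda>a. parkable n {k..n} a \<and> a 1 \<le> Suc (?z a)"
  have ins: "{1..n} = insert 1 {2..n}" using assms by auto
  have "card {a. partial_parking_function n k a} = card {a \<in> {1..n} \<rightarrow>\<^sub>E {1..n}. ?P a}"
    by (simp add: partial_parking_function_iff_greedy [OF assms])
  also have "\<dots> = (\<Sum>a\<in>{1..n} \<rightarrow>\<^sub>E {1..n}. if ?P a then 1 else 0)"
    by (subst sum.inter_filter [symmetric]) (auto intro: finite_PiE)
  also have "\<dots> = (\<Sum>g\<in>{2..n} \<rightarrow>\<^sub>E {1..n}. \<Sum>y\<in>{1..n}. if ?P (g(1 := y)) then 1 else 0)"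
  proof -
    have "1 \<notin> {2..n}" by simp
    from sum_PiE_insert [OF this, of "\<lambda>a. if ?P a then 1 else 0" "\<lambda>_. {1..n}"]
    show ?thesis unfolding ins [symmetric] .
  qed
  also have "\<dots> = (\<Sum>g\<in>{k - (k - 2)..n} \<rightarrow>\<^sub>E {1..n}. if parkable n {k..n} g then ?z g + 1 else 0)"
  proof (rule sum.cong)
    show "({2..n} \<rightarrow>\<^sub>E {1..n}) = ({k - (k - 2)..n} \<rightarrow>\<^sub>E {1..n})" using assms by simp
    fix g :: "nat \<Rightarrow> nat"
    have park: "parkable n {k..n} (g(1 := y)) = parkable n {k..n} g" for y
      by (rule parkable_cong) (use assms in auto)
    have fill: "filled {k..n} (g(1 := y)) = filled {k..n} g" for y
      by (rule filled_cong) (use assms in auto)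
    have gr: "greedy (g(1 := y)) (k - 1) (filled {k..n} g) (k - 2) = ?z g" for y
      by (rule greedy_cong) (use assms in auto)
    have "?z g \<le> filled {k..n} g + (k - 2)" by (rule greedy_le)
    moreover have "filled {k..n} g \<le> n + 1 - k" using filled_le_card [of "{k..n}" g] by simp
    ultimately have "Suc (?z g) \<le> n" using assms by linarith
    \<comment> \<open>The admissible values at coordinate 1 number \<open>?z g + 1\<close>, which is
      the weight in \<open>sum_greedy\<close> at \<open>d = k - 2\<close>.\<close>
    then have "{1..n} \<inter> {y. y \<le> Suc (?z g)} = {1..Suc (?z g)}" by auto
    then show "(\<Sum>y\<in>{1..n}. if ?P (g(1 := y)) then 1 else 0) =
        (if parkable n {k..n} g then ?z g + 1 else 0)"
      by (simp add: park fill gr sum.If_cases del: One_nat_def)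
  qed
  also have "\<dots> = (n + 1) ^ (n + 1 - k + (k - 2))" by (rule sum_greedy) (use assms in auto)
  also have "n + 1 - k + (k - 2) = n - 1" using assms by simp
  finally show ?thesis .
qed

subsection \<open>Burning the graph\<close>

text \<open>With \<open>i < j\<close> fixed, distinct triples give distinct hyperplanes, so arcs
  with multiplicity can be counted as triples. The offset \<open>c\<close> also fixes the direction
  of the arc.\<close>

definition hyperplane_index :: "nat \<Rightarrow> nat \<Rightarrow> (nat \<times> nat \<times> nat) set" where
  "hyperplane_index n k = {(i, j, c). 1 \<le> i \<and> i < j \<and> j \<le> n \<and>
     (c = 0 \<or> i = 1 \<and> 1 \<le> c \<and> c < j \<and> c < k \<or> k \<le> i \<and> c = 1)}"

lemma arrangement_eq_image:
  assumes "1 \<le> k"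
  shows "arrangement n k = (\<lambda>(i, j, c). hyperplane n i j c) ` hyperplane_index n k"
    (is "_ = ?f ` ?X")
proof
  show "arrangement n k \<subseteq> ?f ` ?X"
  proof
    fix H assume "H \<in> arrangement n k"
    then consider
        i j where "H = hyperplane n i j 0" "1 \<le> i" "i < j" "j \<le> n"
      | i j where "H = hyperplane n 1 j i" "1 \<le> i" "i < j" "j \<le> n" "i < k"
      | i j where "H = hyperplane n i j 1" "k \<le> i" "i < j" "j \<le> n"
      unfolding arrangement_def by blast
    then show "H \<in> ?f ` ?X"
    proof cases
      case (1 i j)
      then show ?thesis by (intro image_eqI [of _ _ "(i, j, 0)"]) (auto simp: hyperplane_index_def)
    next
      case (2 i j)
      then show ?thesis by (intro image_eqI [of _ _ "(1, j, i)"]) (auto simp: hyperplane_index_def)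
    next
      case (3 i j)
      then show ?thesis
        using assms by (intro image_eqI [of _ _ "(i, j, 1)"]) (auto simp: hyperplane_index_def)
    qed
  qed
  show "?f ` ?X \<subseteq> arrangement n k"
    by (auto simp: hyperplane_index_def arrangement_def)
qed

lemma inj_on_hyperplane_index:
  "inj_on (\<lambda>(i, j, c). hyperplane n i j c) (hyperplane_index n k)"
proof (rule inj_onI)
  fix x y
  assume X: "x \<in> hyperplane_index n k" "y \<in> hyperplane_index n k"
    and "(\<lambda>(i, j, c). hyperplane n i j c) x = (\<lambda>(i, j, c). hyperplane n i j c) y"
  moreover obtain i j c i' j' c' where xy: "x = (i, j, c)" "y = (i', j', c')"
    by (cases x, cases y)
  ultimately have eq: "hyperplane n i j c = hyperplane n i' j' c'" by simp
  show "x = y"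
    using hyperplane_eqD [OF _ _ _ _ _ eq] X by (auto simp: xy hyperplane_index_def)
qed

lemma arc_ends_of_index:
  assumes "(i, j, c) \<in> hyperplane_index n k"
  shows "arc_ends_of n (hyperplane n i j c) = (if c = 0 then (i, j) else (j, i))"
  using assms by (auto simp: hyperplane_index_def arc_ends_of_0 arc_ends_of_pos)

section \<open>Arcs leaving a vertex set\<close>

definition out_arcs_count :: "nat \<Rightarrow> nat \<Rightarrow> nat set \<Rightarrow> nat \<Rightarrow> nat" where
  "out_arcs_count n k I i =
     card {e \<in> arcs (arr_graph n k). tail (arr_graph n k) e = i \<and> head (arr_graph n k) e \<notin> I}"

lemma out_arcs_count_eq_card_index:
  assumes "1 \<le> k"
  shows "out_arcs_count n k I v =
    card {(i, j, c) \<in> hyperplane_index n k.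
      c = 0 \<and> i = v \<and> j \<notin> I \<or> c \<noteq> 0 \<and> j = v \<and> i \<notin> I}"
    (is "_ = card ?S")
proof -
  let ?f = "\<lambda>(i, j, c). hyperplane n i j c"
  have "{e \<in> arcs (arr_graph n k). tail (arr_graph n k) e = v \<and> head (arr_graph n k) e \<notin> I} = ?f ` ?S"
    (is "?L = _")
  proof (rule set_eqI)
    fix e
    have "e \<in> ?L \<longleftrightarrow> (\<exists>i j c. (i, j, c) \<in> hyperplane_index n k \<and> e = hyperplane n i j c \<and>
        fst (arc_ends_of n e) = v \<and> snd (arc_ends_of n e) \<notin> I)"
      by (auto simp: arr_graph_def arrangement_eq_image [OF assms])
    also have "\<dots> \<longleftrightarrow> (\<exists>i j c. (i, j, c) \<in> ?S \<and> e = hyperplane n i j c)"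
    proof (intro ex_cong1)
      fix i j c
      show "(i, j, c) \<in> hyperplane_index n k \<and> e = hyperplane n i j c \<and>
          fst (arc_ends_of n e) = v \<and> snd (arc_ends_of n e) \<notin> I \<longleftrightarrow>
        (i, j, c) \<in> ?S \<and> e = hyperplane n i j c"
        using arc_ends_of_index [of i j c n k] by (cases "c = 0") auto
    qed
    also have "\<dots> \<longleftrightarrow> e \<in> ?f ` ?S" by (simp only: image_iff Bex_def split_paired_Ex prod.case)
    finally show "e \<in> ?L \<longleftrightarrow> e \<in> ?f ` ?S" .
  qed
  moreover have "inj_on ?f ?S" by (rule inj_on_subset [OF inj_on_hyperplane_index]) auto
  ultimately show ?thesis unfolding out_arcs_count_def by (simp only: card_image)
qed

text \<open>Arcs of positive offset start at the larger index, so only equalities give arcs out of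
  1.\<close>

lemma out_arcs_count_1:
  assumes "2 \<le> k" "1 \<in> I"
  shows "out_arcs_count n k I 1 = card ({1..n} - I)"
proof -
  have "{(i, j, c) \<in> hyperplane_index n k. c = 0 \<and> i = 1 \<and> j \<notin> I \<or> c \<noteq> 0 \<and> j = 1 \<and> i \<notin> I}
      = (\<lambda>j. (1, j, 0)) ` ({1..n} - I)" (is "?S = _")
  proof (rule set_eqI)
    fix x :: "nat \<times> nat \<times> nat"
    obtain i j c where x: "x = (i, j, c)" by (cases x)
    have "j \<notin> I \<Longrightarrow> 1 \<le> j \<Longrightarrow> 1 < j" using assms(2) by (cases "j = 1") auto
    then show "x \<in> ?S \<longleftrightarrow> x \<in> (\<lambda>j. (1, j, 0)) ` ({1..n} - I)"
      by (auto simp: x hyperplane_index_def)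
  qed
  then show ?thesis
    using assms by (simp only: out_arcs_count_eq_card_index) (simp add: card_image inj_on_def)
qed

text \<open>Equalities lead to the larger vertices; the offsets \<open>1 \<le> c < i\<close> give
  \<open>i - 1\<close> parallel arcs to 1.\<close>

lemma out_arcs_count_mid:
  assumes "2 \<le> i" "i < k" "k \<le> n"
  shows "out_arcs_count n k I i = card ({i<..n} - I) + (if 1 \<in> I then 0 else i - 1)"
proof -
  have "1 \<le> k" using assms by simp
  have eq: "{(i', j, c) \<in> hyperplane_index n k. c = 0 \<and> i' = i \<and> j \<notin> I \<or> c \<noteq> 0 \<and> j = i \<and> i' \<notin> I}
      = (\<lambda>j. (i, j, 0)) ` ({i<..n} - I) \<union> (\<lambda>c. (1, i, c)) ` (if 1 \<in> I then {} else {1..<i})"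
    using assms by (auto simp: hyperplane_index_def)
  have "out_arcs_count n k I i = card ((\<lambda>j. (i, j, 0::nat)) ` ({i<..n} - I)) +
      card ((\<lambda>c. (1::nat, i, c)) ` (if 1 \<in> I then {} else {1..<i}))"
    unfolding out_arcs_count_eq_card_index [OF \<open>1 \<le> k\<close>] eq
    using assms by (intro card_Un_disjoint) auto
  then show ?thesis by (simp add: card_image inj_on_def)
qed

text \<open>Two vertices of \<open>{k..n}\<close> are joined once in each direction, upwards by the
  equality and downwards by offset 1, so the count does not depend on \<open>i\<close>. The
  \<open>k - 1\<close> arcs to 1 come from the offsets below \<open>k\<close>.\<close>

lemma out_arcs_count_tail:
  assumes "2 \<le> k" "k \<le> i" "i \<le> n" "i \<in> I"
  shows "out_arcs_count n k I i = card ({k..n} - I) + (if 1 \<in> I then 0 else k - 1)"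
proof -
  have "1 \<le> k" using assms by simp
  have eq: "{(i', j, c) \<in> hyperplane_index n k. c = 0 \<and> i' = i \<and> j \<notin> I \<or> c \<noteq> 0 \<and> j = i \<and> i' \<notin> I}
      = (\<lambda>j. (i, j, 0)) ` ({i<..n} - I) \<union>
        ((\<lambda>c. (1, i, c)) ` (if 1 \<in> I then {} else {1..<k}) \<union> (\<lambda>j. (j, i, 1)) ` ({k..<i} - I))"
    using assms by (auto simp: hyperplane_index_def)
  have "out_arcs_count n k I i = card ((\<lambda>j. (i, j, 0::nat)) ` ({i<..n} - I)) +
      card ((\<lambda>c. (1::nat, i, c)) ` (if 1 \<in> I then {} else {1..<k}) \<union>
        (\<lambda>j. (j, i, 1::nat)) ` ({k..<i} - I))"
    unfolding out_arcs_count_eq_card_index [OF \<open>1 \<le> k\<close>] eq by (intro card_Un_disjoint) auto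
  also have "card ((\<lambda>c. (1::nat, i, c)) ` (if 1 \<in> I then {} else {1..<k}) \<union>
        (\<lambda>j. (j, i, 1::nat)) ` ({k..<i} - I)) =
      card ((\<lambda>c. (1::nat, i, c)) ` (if 1 \<in> I then {} else {1..<k})) +
      card ((\<lambda>j. (j, i, 1::nat)) ` ({k..<i} - I))"
    using assms by (intro card_Un_disjoint) auto
  finally have "out_arcs_count n k I i =
      card ({i<..n} - I) + card ({k..<i} - I) + (if 1 \<in> I then 0 else k - 1)"
    by (simp add: card_image inj_on_def)
  moreover have "card ({i<..n} - I) + card ({k..<i} - I) = card (({i<..n} - I) \<union> ({k..<i} - I))"
    by (rule card_Un_disjoint [symmetric]) auto
  moreover have "({i<..n} - I) \<union> ({k..<i} - I) = {k..n} - I"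
  proof (rule set_eqI)
    fix j
    show "j \<in> ({i<..n} - I) \<union> ({k..<i} - I) \<longleftrightarrow> j \<in> {k..n} - I"
      using assms by (cases "j = i") auto
  qed
  ultimately show ?thesis by simp
qed

lemma graph_parking_function_iff_out_arcs_count:
  "graph_parking_function (arr_graph n k) a \<longleftrightarrow>
    a \<in> {1..n} \<rightarrow>\<^sub>E {1..} \<and>
    (\<forall>I\<subseteq>{1..n}. I \<noteq> {} \<longrightarrow> (\<exists>i\<in>I. a i \<le> Suc (out_arcs_count n k I i)))"
proof -
  have "(int m > int x - 2) = (x \<le> Suc m)" for m x :: nat by linarith
  then show ?thesis
    unfolding graph_parking_function_def out_arcs_count_def by (auto simp: arr_graph_def)
qed

section \<open>Necessity of the two partial parking conditions\<close>

text \<open>Test the singleton \<open>{i}\<close>: every vertex has out-degree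
  \<open>n - 1\<close>.\<close>

lemma graph_parking_function_le:
  assumes "2 \<le> k" "k \<le> n" "graph_parking_function (arr_graph n k) a" "i \<in> {1..n}"
  shows "a i \<le> n"
proof -
  have a: "a i \<le> Suc (out_arcs_count n k {i} i)"
  proof -
    have "{i} \<subseteq> {1..n}" "{i} \<noteq> {}" using assms(4) by auto
    then have "\<exists>l\<in>{i}. a l \<le> Suc (out_arcs_count n k {i} l)"
      using assms(3) unfolding graph_parking_function_iff_out_arcs_count by blast
    then show ?thesis by simp
  qed
  consider "i = 1" | "2 \<le> i" "i < k" | "k \<le> i" using assms by fastforce
  then have "out_arcs_count n k {i} i = n - 1"
  proof cases
    case 1
    then show ?thesis using out_arcs_count_1 [of k "{i}" n] assms by simp
  next
    case 2
    then show ?thesis using out_arcs_count_mid [of i k n "{i}"] assms by simp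
  next
    case 3
    then show ?thesis using out_arcs_count_tail [of k i n "{i}"] assms by auto
  qed
  then show ?thesis using a assms by simp
qed

text \<open>Test the set \<open>I\<close> of cars with values above \<open>n - j\<close>. Each of
  its vertices has \<open>n - card I\<close> arcs leaving \<open>I\<close>, so some value in
  \<open>I\<close> is at most \<open>n + 1 - card I\<close>, which forces
  \<open>card I \<le> j\<close>.\<close>

lemma graph_parking_function_imp_parkable:
  assumes k: "2 \<le> k" "k \<le> n" and a: "graph_parking_function (arr_graph n k) a"
  shows "parkable n {k..n} a"
  unfolding parkable_def
proof (intro allI impI)
  fix j assume "j \<le> n"
  define I where "I = {i \<in> {k..n}. a i = 0 \<or> n - j < a i}"
  have sub: "I \<subseteq> {k..n}" by (auto simp: I_def)
  have ran: "a \<in> {1..n} \<rightarrow>\<^sub>E {1..}"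
    using a by (simp add: graph_parking_function_iff_out_arcs_count)
  show "card I \<le> j"
  proof (cases "I = {}")
    case False
    moreover have "I \<subseteq> {1..n}" using sub k by auto
    ultimately obtain i where i: "i \<in> I" "a i \<le> Suc (out_arcs_count n k I i)"
      using a unfolding graph_parking_function_iff_out_arcs_count by blast
    have ik: "k \<le> i" "i \<le> n" using sub i by auto
    have "1 \<notin> I" using sub k by auto
    have "out_arcs_count n k I i = card ({k..n} - I) + (k - 1)"
      using out_arcs_count_tail [OF k(1) ik i(1)] \<open>1 \<notin> I\<close> by simp
    also have "card ({k..n} - I) = card {k..n} - card I"
      by (rule card_Diff_subset [OF finite_subset [OF sub] sub]) simp
    finally have "a i \<le> Suc (n + 1 - k - card I + (k - 1))" using i by simp
    moreover have "card I \<le> n + 1 - k" using card_mono [OF _ sub] by simp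
    moreover have "a i \<in> {1..}" by (rule PiE_mem [OF ran]) (use ik k in auto)
    then have "n - j < a i" using i by (simp add: I_def)
    ultimately show ?thesis using k \<open>j \<le> n\<close> by linarith
  qed simp
qed

text \<open>The set burnt before vertex \<open>1\<close>. Elements of the centre above \<open>k\<close> are positions in the
  sorted tail, so they are replaced by the vertices carrying the small values.\<close>

definition burnt :: "nat \<Rightarrow> nat \<Rightarrow> (nat \<Rightarrow> nat) \<Rightarrow> nat set" where
  "burnt n k a = (centre n (tail_sorted n k a) \<inter> {2..<k}) \<union>
     {i \<in> {k..n}. a i \<le> Suc (filled {k..n} a)}"

text \<open>Exchanging positions for vertices preserves the count because both tail parts have
  \<open>filled {k..n} a\<close> elements.\<close>

lemma card_burnt_above:
  assumes "2 \<le> k" "k \<le> n" "1 \<le> i" "i < k"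
  shows "card (burnt n k a \<inter> {i<..n}) = card (centre n (tail_sorted n k a) \<inter> {i<..n})"
proof -
  let ?Z = "centre n (tail_sorted n k a)"
  let ?T = "{i \<in> {k..n}. a i \<le> Suc (filled {k..n} a)}"
  have "burnt n k a \<inter> {i<..n} = (?Z \<inter> {i<..<k}) \<union> ?T"
    using assms by (auto simp: burnt_def)
  moreover have "card ((?Z \<inter> {i<..<k}) \<union> ?T) = card (?Z \<inter> {i<..<k}) + card ?T"
    by (rule card_Un_disjoint) auto
  moreover have "card ?T = filled {k..n} a" by (rule card_filled) simp
  moreover have "card (?Z \<inter> {k..n}) = filled {k..n} a"
    by (rule card_centre_tail_sorted) (use assms in simp)
  moreover have "card ((?Z \<inter> {i<..<k}) \<union> (?Z \<inter> {k..n})) =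
      card (?Z \<inter> {i<..<k}) + card (?Z \<inter> {k..n})"
    by (rule card_Un_disjoint) auto
  moreover have "?Z \<inter> {i<..n} = (?Z \<inter> {i<..<k}) \<union> (?Z \<inter> {k..n})" using assms by auto
  ultimately show ?thesis by presburger
qed

lemma mem_centre_iff_burnt:
  assumes "2 \<le> k" "k \<le> n" "1 \<le> i" "i < k"
  shows "i \<in> centre n (tail_sorted n k a) \<longleftrightarrow> a i \<le> Suc (card (burnt n k a \<inter> {i<..n}))"
  using assms mem_centre_iff [of i n "tail_sorted n k a"] tail_sorted_below [of k i n a]
  by (simp add: card_burnt_above)

lemma burnt_subset: "2 \<le> k \<Longrightarrow> burnt n k a \<subseteq> {1<..n}"
  using centre_subset [of n "tail_sorted n k a"] by (auto simp: burnt_def)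

text \<open>Test the complement of \<open>burnt\<close>. A vertex other than 1 satisfying the
  condition would itself belong to \<open>burnt\<close>, so the condition holds at 1, where it is
  membership in the centre.\<close>

lemma graph_parking_function_imp_centre:
  assumes k: "2 \<le> k" "k \<le> n" and a: "graph_parking_function (arr_graph n k) a"
  shows "1 \<in> centre n (tail_sorted n k a)"
proof -
  let ?B = "burnt n k a"
  define I where "I = {1..n} - ?B"
  have B: "?B \<subseteq> {1<..n}" using burnt_subset k by blast
  have I: "1 \<in> I" "I \<subseteq> {1..n}" using B k by (auto simp: I_def)
  then obtain i where i: "i \<in> I" "a i \<le> Suc (out_arcs_count n k I i)"
    using a unfolding graph_parking_function_iff_out_arcs_count by blast
  consider "i = 1" | "2 \<le> i" "i < k" | "k \<le> i" "i \<le> n" using i I by fastforce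
  then show ?thesis
  proof cases
    case 1
    have "{1..n} - I = ?B \<inter> {1<..n}" using B by (auto simp: I_def)
    then have "a 1 \<le> Suc (card (?B \<inter> {1<..n}))"
      using i(2) 1 out_arcs_count_1 [OF k(1) I(1), of n] by simp
    then show ?thesis using mem_centre_iff_burnt [of k n 1 a] k by simp
  next
    case 2
    have "{i<..n} - I = ?B \<inter> {i<..n}" using 2 by (auto simp: I_def)
    then have "a i \<le> Suc (card (?B \<inter> {i<..n}))"
      using i(2) out_arcs_count_mid [OF 2 k(2), of I] I(1) by simp
    then have "i \<in> ?B" using mem_centre_iff_burnt [of k n i a] k 2 by (simp add: burnt_def)
    then show ?thesis using i by (simp add: I_def)
  next
    case 3
    have "{k..n} - I = {i \<in> {k..n}. a i \<le> Suc (filled {k..n} a)}" using k by (auto simp: I_def burnt_def)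
    then have "a i \<le> Suc (filled {k..n} a)"
      using i(2) out_arcs_count_tail [OF k(1) 3 i(1)] I(1) card_filled [of "{k..n}" a] by simp
    then have "i \<in> ?B" using 3 by (simp add: burnt_def)
    then show ?thesis using i by (simp add: I_def)
  qed
qed

section \<open>Sufficiency\<close>

text \<open>The search for \<open>i\<close> follows the burning order: while 1 is in
  \<open>I\<close>, first the small values in the tail, then the rest of \<open>burnt\<close>, then
  1; once 1 has left \<open>I\<close>, first \<open>{k..n}\<close>, then the largest remaining
  vertex.\<close>

lemma ex_le_out_arcs_count:
  assumes k: "2 \<le> k" "k \<le> n" and a: "a \<in> {1..n} \<rightarrow>\<^sub>E {1..n}" and park: "parkable n {k..n} a"
    and Z: "1 \<in> centre n (tail_sorted n k a)"
    and I: "I \<subseteq> {1..n}" "I \<noteq> {}"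
  shows "\<exists>i\<in>I. a i \<le> Suc (out_arcs_count n k I i)"
proof (cases "1 \<in> I")
  case False
  show ?thesis
  proof (cases "I \<inter> {k..n} = {}")
    case True
    \<comment> \<open>All \<open>n - i\<close> larger vertices lie outside \<open>I\<close>, which
      with the \<open>i - 1\<close> arcs to 1 gives \<open>n - 1\<close> arcs.\<close>
    define i where "i = Max I"
    have fin: "finite I" using I finite_subset by blast
    have i: "i \<in> I" "\<And>j. j \<in> I \<Longrightarrow> j \<le> i" using I fin by (auto simp: i_def)
    have ik: "2 \<le> i" "i < k"
    proof -
      have "i \<noteq> 1" "i \<in> {1..n}" "i \<notin> {k..n}" using i(1) False I True by auto
      then show "2 \<le> i" "i < k" by auto
    qed
    have "{i<..n} - I = {i<..n}" using i(2) by fastforce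
    then have "out_arcs_count n k I i = n - 1"
      using out_arcs_count_mid [OF ik k(2), of I] False ik k by simp
    moreover have "a i \<le> n" using a i(1) I by auto
    ultimately show ?thesis using i(1) by force
  next
    case nonempty: False
    define J where "J = I \<inter> {k..n}"
    have J: "J \<subseteq> {k..n}" "J \<noteq> {}" "finite J" using nonempty by (auto simp: J_def)
    have cJ: "1 \<le> card J" using J by (simp add: Suc_le_eq card_gt_0_iff)
    have cJn: "card J \<le> n + 1 - k" using card_mono [OF _ J(1)] by simp
    \<comment> \<open>Parkability at \<open>card J - 1\<close> leaves some value in \<open>J\<close>
      of at most \<open>n - card J + 1\<close>; the matching arc count is
      \<open>n - card J\<close>.\<close>
    have "\<not> J \<subseteq> {i \<in> {k..n}. a i = 0 \<or> n - (card J - 1) < a i}" (is "\<not> J \<subseteq> ?S")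
    proof
      assume "J \<subseteq> ?S"
      then have "card J \<le> card ?S" by (intro card_mono) auto
      moreover have "card J - 1 \<le> n" using cJn by linarith
      then have "card ?S \<le> card J - 1" using park unfolding parkable_def by blast
      ultimately show False using cJ by linarith
    qed
    then obtain i where i: "i \<in> J" "a i \<le> n - (card J - 1)" using J(1) by fastforce
    have iI: "i \<in> I" "k \<le> i" "i \<le> n" using i by (auto simp: J_def)
    have "{k..n} - I = {k..n} - J" by (auto simp: J_def)
    then have "out_arcs_count n k I i = (n + 1 - k - card J) + (k - 1)"
      using out_arcs_count_tail [OF k(1) iI(2,3,1)] False card_Diff_subset [OF J(3,1)] by simp
    then have "a i \<le> Suc (out_arcs_count n k I i)" using i(2) cJ cJn k by linarith
    then show ?thesis using iI by blast
  qed
next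
  case True
  define t where "t = filled {k..n} a"
  define T where "T = {i \<in> {k..n}. a i \<le> Suc t}"
  let ?B = "burnt n k a"
  have cT: "card T = t" "finite T" unfolding T_def t_def by (rule card_filled) auto
  have TB: "T \<subseteq> ?B" by (auto simp: burnt_def T_def t_def)
  have B: "?B \<subseteq> {1<..n}" "finite ?B" using burnt_subset [OF k(1)] finite_subset by blast+
  consider "I \<inter> T \<noteq> {}" | "I \<inter> T = {}" "I \<inter> ?B \<noteq> {}" | "I \<inter> ?B = {}" by blast
  then show ?thesis
  proof cases
    case 1
    define J where "J = I \<inter> T"
    have J: "J \<subseteq> T" "J \<noteq> {}" "finite J" using 1 cT by (auto simp: J_def)
    have cJ: "1 \<le> card J" using J by (simp add: Suc_le_eq card_gt_0_iff)
    have cJt: "card J \<le> t" using card_mono [OF cT(2) J(1)] cT by simp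
    \<comment> \<open>\<open>T - J\<close> has only \<open>s - 1\<close> elements, while at least
      \<open>s\<close> tail vertices have values up to \<open>s\<close>, all of them in
      \<open>T\<close>; hence one lies in \<open>J\<close>.\<close>
    define s where "s = Suc (t - card J)"
    have s: "s \<le> t" using cJ cJt by (simp add: s_def)
    let ?S = "{i \<in> {k..n}. a i \<le> s}"
    have ST: "?S \<subseteq> T" using s by (auto simp: T_def)
    have "?S \<inter> J \<noteq> {}"
    proof
      assume "?S \<inter> J = {}"
      then have "?S \<subseteq> T - J" using ST by blast
      then have "card ?S \<le> card (T - J)" by (rule card_mono [rotated]) (use cT in simp)
      also have "\<dots> = t - card J" using card_Diff_subset [OF J(3,1)] cT by simp
      also have "\<dots> < s" by (simp add: s_def)
      also have "s \<le> card ?S" using s unfolding t_def by (rule le_card_if_le_filled)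
      finally show False by simp
    qed
    then obtain i where i: "i \<in> J" "i \<in> {k..n}" "a i \<le> s" by blast
    have iI: "i \<in> I" using i by (simp add: J_def)
    have "t - card J = card (T - J)" using card_Diff_subset [OF J(3,1)] cT by simp
    also have "\<dots> \<le> card ({k..n} - I)" by (rule card_mono) (auto simp: J_def T_def)
    also have "\<dots> = out_arcs_count n k I i"
      using out_arcs_count_tail [OF k(1) _ _ iI] i True by simp
    finally have "a i \<le> Suc (out_arcs_count n k I i)" using i(3) by (simp add: s_def)
    then show ?thesis using iI by blast
  next
    case 2
    \<comment> \<open>By maximality every burnt vertex above \<open>i\<close> lies outside
      \<open>I\<close>.\<close>
    define i where "i = Max (I \<inter> ?B)"
    have i: "i \<in> I \<inter> ?B" "\<And>j. j \<in> I \<inter> ?B \<Longrightarrow> j \<le> i"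
      using 2(2) B(2) by (auto simp: i_def simp del: Int_iff intro!: Max_in)
    have "i \<in> ?B" "i \<notin> T" using i(1) 2(1) by auto
    then have ik: "i \<in> centre n (tail_sorted n k a)" "2 \<le> i" "i < k"
      by (auto simp: burnt_def T_def t_def)
    have "a i \<le> Suc (card (?B \<inter> {i<..n}))"
      using mem_centre_iff_burnt [of k n i a] k ik by simp
    also have "card (?B \<inter> {i<..n}) \<le> card ({i<..n} - I)"
    proof (rule card_mono)
      show "?B \<inter> {i<..n} \<subseteq> {i<..n} - I" using i(2) by fastforce
    qed simp
    also have "\<dots> = out_arcs_count n k I i"
      using out_arcs_count_mid [OF ik(2,3) k(2), of I] True by simp
    finally show ?thesis using i(1) by blast
  next
    case 3
    have "a 1 \<le> Suc (card (?B \<inter> {1<..n}))"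
      using mem_centre_iff_burnt [of k n 1 a] k Z by simp
    also have "card (?B \<inter> {1<..n}) \<le> card ({1..n} - I)"
      by (rule card_mono) (use 3 B in auto)
    also have "\<dots> = out_arcs_count n k I 1" using out_arcs_count_1 [OF k(1) True] by simp
    finally show ?thesis using True by blast
  qed
qed

lemma graph_parking_function_iff_partial:
  assumes "2 \<le> k" "k \<le> n"
  shows "graph_parking_function (arr_graph n k) a \<longleftrightarrow> partial_parking_function n k a"
proof
  assume a: "graph_parking_function (arr_graph n k) a"
  then have "a \<in> {1..n} \<rightarrow>\<^sub>E {1..}" by (simp add: graph_parking_function_iff_out_arcs_count)
  then have "a \<in> {1..n} \<rightarrow>\<^sub>E {1..n}"
    using graph_parking_function_le [OF assms a] by (auto simp: PiE_iff)
  then show "partial_parking_function n k a"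
    using assms graph_parking_function_imp_parkable [OF assms a]
      graph_parking_function_imp_centre [OF assms a]
    by (simp add: partial_parking_function_iff_centre)
next
  assume "partial_parking_function n k a"
  then have a: "a \<in> {1..n} \<rightarrow>\<^sub>E {1..n}" "parkable n {k..n} a" "1 \<in> centre n (tail_sorted n k a)"
    using assms by (simp_all add: partial_parking_function_iff_centre)
  then have "a \<in> {1..n} \<rightarrow>\<^sub>E {1..}" by (auto simp: PiE_iff)
  then show "graph_parking_function (arr_graph n k) a"
    using ex_le_out_arcs_count [OF assms a]
    by (simp add: graph_parking_function_iff_out_arcs_count)
qed

theorem theorem5p1:
  fixes n k :: nat
  assumes "n \<ge> 3" and "2 \<le> k" and "k \<le> n"
  shows "{a. graph_parking_function (arr_graph n k) a} = {a. partial_parking_function n k a} \<and>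
         card {a. graph_parking_function (arr_graph n k) a} = (n + 1) ^ (n - 1)"
  using assms(2,3)
  by (simp only: graph_parking_function_iff_partial card_partial_parking_functions)

end
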